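(* If the cone $\mathcal{CS}_+$ of completely positive semidefinite matrices is closed (i.e. $\mathcal{CS}_+^n$ is closed for every $n\ge1$), then the set $\mathcal Q$ of quantum correlations is also closed (for every Bell scenario, i.e. all finite nonempty sets $S,T,A,B$).
   Context: $\mathcal{CS}_+^n$ is the set of real symmetric $n\times n$ matrices of the form $(\mathrm{Tr}(X_iX_j))_{i,j=1}^n$ with $X_1,\dots,X_n$ real symmetric positive semidefinite (psd) $d\times d$ matrices for some $d\ge1$. Given finite sets $S,T$ (questions) and $A,B$ (answers), $\mathcal{Q}\subseteq\mathbb R^{|A\times B\times S\times T|}$ is the set of vectors $p=(p(a,b|s,t))$ for which there are finite-dimensional complex Euclidean spaces $\mathcal X,\mathcal Y$, a unit vector $\psi\in\mathcal X\otimes\mathcal Y$, Hermitian psd operators $X_a^s$ on $\mathcal X$ with $\sum_{a\in A} X_a^s=\mathbb I_{\mathcal X}$ for each $s\in S$, and Hermitian psd operators $Y_b^t$ on $\mathcal Y$ with $\sum_{b\in B} Y_b^t=\mathbb I_{\mathcal Y}$ for each $t\in T$, such that $p(a,b|s,t)=\psi^*(X_a^s\otimes Y_b^t)\psi$ for all $a,b,s,t$. *)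

theory Defs
  imports
    "HOL-Analysis.Function_Topology"
    "Jordan_Normal_Form.Schur_Decomposition"
begin

text \<open>Over \<^typ>\<open>real\<close> conjugation is the identity, so this says real symmetric psd; over
  \<^typ>\<open>complex\<close> it says Hermitian psd, where \<open>0 \<le> z\<close> means that \<open>z\<close> is real and nonnegative.\<close>

definition psd_mat :: "nat \<Rightarrow> 'a :: conjugatable_ordered_field mat \<Rightarrow> bool" where
  "psd_mat d M \<longleftrightarrow> M \<in> carrier_mat d d \<and> mat_adjoint M = M \<and>
     (\<forall>v \<in> carrier_vec d. 0 \<le> (M *\<^sub>v v) \<bullet>c v)"

definition mat_trace :: "'a :: comm_monoid_add mat \<Rightarrow> 'a" where
  "mat_trace M = (\<Sum>i<dim_row M. M $$ (i, i))"

text \<open>A vector of \<open>\<real>\<^sup>I\<close>, for a finite index set \<open>I\<close>, is an extensional function on \<open>I\<close>, so that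
  the topology of \<open>\<real>\<^sup>I\<close> is \<^term>\<open>powertop_real I\<close>. In particular the \<open>n \<times> n\<close> matrices in the
  following set, whose topology matters, are elements of \<open>\<real>\<^sup>I\<close> for \<open>I = {..<n} \<times> {..<n}\<close>.\<close>

definition cpsd_cone :: "nat \<Rightarrow> (nat \<times> nat \<Rightarrow> real) set" where
  "cpsd_cone n = {M. \<exists>d\<ge>1. \<exists>X :: nat \<Rightarrow> real mat.
     (\<forall>i<n. psd_mat d (X i)) \<and>
     M = (\<lambda>(i, j) \<in> {..<n} \<times> {..<n}. mat_trace (X i * X j))}"

text \<open>The Kronecker product represents the tensor product of operators on
  \<open>\<complex>\<^sup>d \<otimes> \<complex>\<^sup>e = \<complex>\<^bsup>d e\<^esup>\<close>, with the basis vector \<open>e\<^sub>i \<otimes> e\<^sub>j\<close> in position \<open>i e + j\<close>.\<close>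

definition kronecker :: "'a :: times mat \<Rightarrow> 'a mat \<Rightarrow> 'a mat" where
  "kronecker M N = mat (dim_row M * dim_row N) (dim_col M * dim_col N)
     (\<lambda>(i, j). M $$ (i div dim_row N, j div dim_col N) * N $$ (i mod dim_row N, j mod dim_col N))"

text \<open>The sum of the operators is written entrywise, as matrices of unspecified
  dimension form no additive monoid.\<close>

definition povm :: "nat \<Rightarrow> 'a set \<Rightarrow> ('a \<Rightarrow> complex mat) \<Rightarrow> bool" where
  "povm d A X \<longleftrightarrow> (\<forall>a\<in>A. psd_mat d (X a)) \<and> mat d d (\<lambda>ij. \<Sum>a\<in>A. X a $$ ij) = 1\<^sub>m d"

text \<open>The entry \<open>p(a,b|s,t)\<close> is \<open>p (a, b, s, t)\<close>. As \<open>u \<bullet>c v\<close> conjugates \<open>v\<close>, the number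
  \<open>\<psi>\<^sup>* M \<psi>\<close> is \<open>(M *\<^sub>v \<psi>) \<bullet>c \<psi>\<close>.\<close>

definition quantum_correlations ::
    "'a set \<Rightarrow> 'b set \<Rightarrow> 's set \<Rightarrow> 't set \<Rightarrow> ('a \<times> 'b \<times> 's \<times> 't \<Rightarrow> real) set" where
  "quantum_correlations A B S T = {p \<in> extensional (A \<times> B \<times> S \<times> T).
     \<exists>d e. \<exists>\<psi> \<in> carrier_vec (d * e).
     \<exists>(X :: 's \<Rightarrow> 'a \<Rightarrow> complex mat) (Y :: 't \<Rightarrow> 'b \<Rightarrow> complex mat).
       \<psi> \<bullet>c \<psi> = 1 \<and>
       (\<forall>s\<in>S. povm d A (X s)) \<and>
       (\<forall>t\<in>T. povm e B (Y t)) \<and>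
       (\<forall>a\<in>A. \<forall>b\<in>B. \<forall>s\<in>S. \<forall>t\<in>T.
          complex_of_real (p (a, b, s, t)) = (kronecker (X s a) (Y t b) *\<^sub>v \<psi>) \<bullet>c \<psi>)}"

end

theory Submission
  imports Defs "HOL-Analysis.T1_Spaces" "Jordan_Normal_Form.Spectral_Radius"
begin

text \<open>A correlation is quantum iff it occurs as a block of a matrix in \<open>\<C>\<S>\<^sub>+\<close> (indexed by all
  question-answer pairs of both parties) each of whose question-by-question blocks has entry sum 1
  (Sikora and Varvitsiotis). From \<open>\<psi> = vec \<Psi>\<close> with \<open>\<Psi> = U \<bar>\<Psi>\<bar>\<close> one gets the Gram operators
  \<open>\<bar>\<Psi>\<bar>\<^sup>1\<^sup>/\<^sup>2 U\<^sup>* X\<^sub>a U \<bar>\<Psi>\<bar>\<^sup>1\<^sup>/\<^sup>2\<close> and \<open>\<bar>\<Psi>\<bar>\<^sup>1\<^sup>/\<^sup>2 Y\<^sub>b\<^sup>T \<bar>\<Psi>\<bar>\<^sup>1\<^sup>/\<^sup>2\<close>. Conversely, the block sums force the operators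
  of every question to have the same sum \<open>K\<close>, and conjugation by \<open>K\<^sup>-\<^sup>1\<^sup>/\<^sup>2\<close> turns them into
  measurements on the state \<open>vec K\<close>. Traces of products of psd matrices are nonnegative, so the entries
  of these matrices lie in \<open>[0, 1]\<close>; if \<open>\<C>\<S>\<^sub>+\<close> is closed, the set of quantum correlations is
  therefore a projection of a compact set.\<close>

section \<open>Adjoints and positive semidefinite matrices\<close>

lemma mult_mat_assoc_dim:
  "dim_col P = dim_row Q \<Longrightarrow> dim_col Q = dim_row R \<Longrightarrow> P * Q * R = P * (Q * R)"
  for P Q R :: "'a :: semiring_0 mat"
  by (rule assoc_mult_mat[of _ "dim_row P" "dim_col P" _ "dim_col Q" _ "dim_col R"]) auto

lemma dim_mat_adjoint [simp]:
  "dim_row (mat_adjoint M) = dim_col M" "dim_col (mat_adjoint M) = dim_row M"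
  by (simp_all add: mat_adjoint_def mat_of_rows_def)

lemma index_mat_adjoint [simp]:
  "i < dim_col M \<Longrightarrow> j < dim_row M \<Longrightarrow> mat_adjoint M $$ (i, j) = conjugate (M $$ (j, i))"
  by (simp add: mat_adjoint_def mat_of_rows_def)

lemma mat_adjoint_carrier [simp]: "M \<in> carrier_mat m n \<Longrightarrow> mat_adjoint M \<in> carrier_mat n m"
  by (intro carrier_matI) auto

lemma mat_adjoint_adjoint [simp]: "mat_adjoint (mat_adjoint M) = M"
  by (rule eq_matI) auto

lemma mat_adjoint_mult:
  assumes "dim_col M = dim_row N"
  shows "mat_adjoint (M * N) = mat_adjoint N * mat_adjoint M"
  using assms
  by (intro eq_matI)
     (auto simp: scalar_prod_def sum_conjugate conjugate_dist_mul mult.commute intro!: sum.cong)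

lemma mat_adjoint_diag [simp]:
  "mat_adjoint (mat_diag n f) = mat_diag n (\<lambda>i. conjugate (f i))"
  by (rule eq_matI) (auto simp: mat_diag_def)

lemma mat_adjoint_one [simp]: "mat_adjoint (1\<^sub>m n :: complex mat) = 1\<^sub>m n"
  by (rule eq_matI) auto

lemma mat_diag_dims [simp]: "dim_row (mat_diag n f) = n" "dim_col (mat_diag n f) = n"
  by (simp_all add: mat_diag_def)

lemma mult_mat_vec_assoc_dim:
  "dim_col P = dim_row Q \<Longrightarrow> dim_col Q = dim_vec v \<Longrightarrow> P * Q *\<^sub>v v = P *\<^sub>v (Q *\<^sub>v v)"
  for P Q :: "'a :: semiring_0 mat"
  by (rule assoc_mult_mat_vec[of _ "dim_row P" "dim_col P" _ "dim_col Q"]) auto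

lemma adjoint_cscalar_prod:
  assumes M: "M \<in> carrier_mat m n" and w: "w \<in> carrier_vec m" and v: "v \<in> carrier_vec n"
  shows "(mat_adjoint M *\<^sub>v w) \<bullet>c v = w \<bullet>c (M *\<^sub>v v)"
proof -
  have "(mat_adjoint M *\<^sub>v w) \<bullet>c v
      = (\<Sum>i<n. \<Sum>j<m. conjugate (M $$ (j, i)) * w $ j * conjugate (v $ i))"
    using assms by (simp add: scalar_prod_def sum_distrib_right lessThan_atLeast0)
  also have "\<dots> = (\<Sum>j<m. \<Sum>i<n. conjugate (M $$ (j, i)) * w $ j * conjugate (v $ i))"
    by (rule sum.swap)
  also have "\<dots> = w \<bullet>c (M *\<^sub>v v)"
    using assms by (simp add: scalar_prod_def sum_distrib_left lessThan_atLeast0 sum_conjugate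
        conjugate_dist_mul mult_ac)
  finally show ?thesis .
qed

lemma psd_matD:
  assumes "psd_mat d M"
  shows "M \<in> carrier_mat d d" "mat_adjoint M = M" "dim_row M = d" "dim_col M = d"
    "v \<in> carrier_vec d \<Longrightarrow> 0 \<le> (M *\<^sub>v v) \<bullet>c v"
  using assms by (auto simp: psd_mat_def)

text \<open>The quadratic form of \<open>C\<^sup>* M C\<close> at \<open>v\<close> is that of
  \<open>M\<close> at \<open>C v\<close>.\<close>

lemma psd_mat_congruence:
  assumes M: "psd_mat d M" and C: "C \<in> carrier_mat d e"
  shows "psd_mat e (mat_adjoint C * M * C)"
  unfolding psd_mat_def
proof (intro conjI ballI)
  note [simp] = psd_matD(2-4)[OF M]
  have Md: "M \<in> carrier_mat d d" using M by (rule psd_matD)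
  have Cd [simp]: "dim_row C = d" "dim_col C = e" using C by auto
  show "mat_adjoint C * M * C \<in> carrier_mat e e"
    by (intro carrier_matI) simp_all
  show "mat_adjoint (mat_adjoint C * M * C) = mat_adjoint C * M * C"
    by (simp add: mat_adjoint_mult mult_mat_assoc_dim del: assoc_mult_mat)
  fix v :: "'a vec" assume v: "v \<in> carrier_vec e"
  have Cv: "C *\<^sub>v v \<in> carrier_vec d" using C v by auto
  have "(mat_adjoint C * M * C) *\<^sub>v v = mat_adjoint C *\<^sub>v (M *\<^sub>v (C *\<^sub>v v))"
    using v by (simp add: mult_mat_vec_assoc_dim del: assoc_mult_mat assoc_mult_mat_vec)
  then show "0 \<le> ((mat_adjoint C * M * C) *\<^sub>v v) \<bullet>c v"
    using adjoint_cscalar_prod[OF C _ v, of "M *\<^sub>v (C *\<^sub>v v)"] psd_matD(5)[OF M Cv] Md Cv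
    by simp
qed

lemma psd_mat_one: "psd_mat d (1\<^sub>m d :: complex mat)"
  by (auto simp: psd_mat_def)

lemma psd_mat_gram:
  assumes "C \<in> carrier_mat d e"
  shows "psd_mat e (mat_adjoint C * C :: complex mat)"
  using psd_mat_congruence[OF psd_mat_one assms] assms by simp

lemma psd_mat_diag_entry:
  fixes M :: "complex mat"
  assumes M: "psd_mat d M" and i: "i < d"
  shows "0 \<le> M $$ (i, i)"
proof -
  have "0 \<le> (M *\<^sub>v unit_vec d i) \<bullet>c unit_vec d i"
    by (rule psd_matD(5)[OF M]) simp
  also have "conjugate (unit_vec d i) = (unit_vec d i :: complex vec)"
    using i by (intro eq_vecI) (auto simp: unit_vec_def)
  also have "(M *\<^sub>v unit_vec d i) \<bullet> unit_vec d i = M $$ (i, i)"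
    using i psd_matD(3,4)[OF M] by simp
  finally show ?thesis .
qed

section \<open>Traces of products\<close>

lemma mat_trace_mult:
  assumes "M \<in> carrier_mat m n" "N \<in> carrier_mat n m"
  shows "mat_trace (M * N) = (\<Sum>i<m. \<Sum>j<n. M $$ (i, j) * N $$ (j, i))"
  using assms by (simp add: mat_trace_def scalar_prod_def lessThan_atLeast0)

lemma mat_trace_mult_comm:
  fixes M N :: "'a :: comm_semiring_0 mat"
  assumes "dim_row M = dim_col N" "dim_col M = dim_row N"
  shows "mat_trace (M * N) = mat_trace (N * M)"
proof -
  have M: "M \<in> carrier_mat (dim_row M) (dim_row N)" and N: "N \<in> carrier_mat (dim_row N) (dim_row M)"
    using assms by auto
  show ?thesis
    unfolding mat_trace_mult[OF M N] mat_trace_mult[OF N M]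
    by (subst sum.swap) (simp add: mult.commute)
qed

section \<open>Diagonalization of Hermitian matrices\<close>

text \<open>Gram-Schmidt on a basis that starts with \<open>v\<close> keeps \<open>v\<close> in
  first place; dividing each vector by its norm gives the columns of \<open>W\<close>. This supplies
  the change of basis that splits off an eigenvector.\<close>

lemma unitary_with_first_column:
  fixes v :: "complex vec"
  assumes v: "v \<in> carrier_vec n" and v0: "v \<noteq> 0\<^sub>v n" and n: "0 < n"
  obtains W c where "W \<in> carrier_mat n n" "mat_adjoint W * W = 1\<^sub>m n" "col W 0 = c \<cdot>\<^sub>v v"
proof -
  interpret cof_vec_space n "TYPE(complex)" .
  note completion = basis_completion[OF v v0]
  obtain us where us: "basis_completion v = v # us"
    using completion(6,7) n by (cases "basis_completion v") auto
  define ws where "ws = gram_schmidt n (basis_completion v)"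
  have ws: "corthogonal ws" "set ws \<subseteq> carrier_vec n" "length ws = n"
    using gram_schmidt_result[OF completion(2,4,5) ws_def] completion(6) by auto
  have hd: "hd ws = v"
    using gram_schmidt_hd[OF v, of us] by (simp add: ws_def us)
  then have ws0: "ws ! 0 = v"
    using ws(3) n by (metis hd_conv_nth length_greater_0_conv)
  have wsc: "ws ! i \<in> carrier_vec n" if "i < n" for i
    using ws that by auto
  \<comment> \<open>The inverse norm; being real, it passes through conjugation unchanged.\<close>
  define c where "c i = complex_of_real (inverse (sqrt (Re (ws ! i \<bullet>c ws ! i))))" for i
  have c_real: "cnj (c i) = c i" for i by (simp add: c_def)
  define W where "W = mat n n (\<lambda>(i, j). c j * ws ! j $ i)"
  have W: "W \<in> carrier_mat n n" by (simp add: W_def)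
  have pos: "0 < ws ! i \<bullet>c ws ! i" if "i < n" for i
  proof -
    have "ws ! i \<bullet>c ws ! i \<noteq> 0" using corthogonalD[OF ws(1), of i i] that ws(3) by auto
    moreover have "0 \<le> ws ! i \<bullet>c ws ! i" by (rule conjugate_square_ge_0_vec)
    ultimately show ?thesis by (simp add: order.strict_iff_order)
  qed
  have norm: "c i * c i * (ws ! i \<bullet>c ws ! i) = 1" if "i < n" for i
  proof -
    define r where "r = Re (ws ! i \<bullet>c ws ! i)"
    have r: "ws ! i \<bullet>c ws ! i = complex_of_real r" "0 < r"
      using pos[OF that] by (auto simp: r_def complex_eq_iff less_complex_def)
    have "inverse (sqrt r) * inverse (sqrt r) * r = 1"
      using r(2) by (simp add: field_simps)
    then show ?thesis
      unfolding c_def r_def[symmetric] of_real_mult[symmetric]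
      by (simp only: r(1) of_real_mult[symmetric] of_real_1)
  qed
  have "mat_adjoint W * W = 1\<^sub>m n"
  proof (rule eq_matI)
    fix i j assume "i < dim_row (1\<^sub>m n :: complex mat)" "j < dim_col (1\<^sub>m n :: complex mat)"
    then have ij: "i < n" "j < n" by auto
    have "(mat_adjoint W * W) $$ (i, j) = (\<Sum>k<n. cnj (c i * ws ! i $ k) * (c j * ws ! j $ k))"
      using ij W by (simp add: scalar_prod_def lessThan_atLeast0 W_def)
    also have "\<dots> = c i * c j * (ws ! j \<bullet>c ws ! i)"
      using wsc[OF ij(1)] wsc[OF ij(2)] c_real
      by (simp add: scalar_prod_def lessThan_atLeast0 sum_distrib_left sum_distrib_right mult_ac)
    also have "\<dots> = 1\<^sub>m n $$ (i, j)"
      using norm[of i] corthogonalD[OF ws(1), of j i] ij ws(3) by auto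
    finally show "(mat_adjoint W * W) $$ (i, j) = 1\<^sub>m n $$ (i, j)" .
  qed (use W in auto)
  moreover have "col W 0 = c 0 \<cdot>\<^sub>v v"
    using n v by (intro eq_vecI) (auto simp: W_def ws0)
  ultimately show thesis using that W by blast
qed

text \<open>Induction by deflation. In a unitary basis that starts with an eigenvector, the first
  column is zero below the eigenvalue, and Hermitian symmetry clears the first row as well. What
  remains is a Hermitian block of size \<open>n\<close>.\<close>

lemma hermitian_diagonalization:
  fixes M :: "complex mat"
  assumes "M \<in> carrier_mat n n" "mat_adjoint M = M"
  shows "\<exists>V f. V \<in> carrier_mat n n \<and> mat_adjoint V * V = 1\<^sub>m n \<and>
    mat_adjoint V * M * V = mat_diag n f"
  using assms
proof (induction n arbitrary: M)
  case 0
  then show ?case by (intro exI[of _ "1\<^sub>m 0"] exI[of _ "\<lambda>_. 0"]) auto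
next
  case (Suc n M)
  have M [simp]: "dim_row M = Suc n" "dim_col M = Suc n" using Suc.prems(1) by auto
  obtain e v where ev: "eigenvector M v e"
    using spectrum_non_empty[OF Suc.prems(1)] by (auto simp: spectrum_def eigenvalue_def)
  then have v: "v \<in> carrier_vec (Suc n)" "v \<noteq> 0\<^sub>v (Suc n)" "M *\<^sub>v v = e \<cdot>\<^sub>v v"
    by (auto simp: eigenvector_def)
  obtain W c where W: "W \<in> carrier_mat (Suc n) (Suc n)" "mat_adjoint W * W = 1\<^sub>m (Suc n)"
    "col W 0 = c \<cdot>\<^sub>v v"
    using unitary_with_first_column[OF v(1,2)] by blast
  note [simp del] = assoc_mult_mat
  have Wd [simp]: "dim_row W = Suc n" "dim_col W = Suc n" using W by auto
  define N where "N = mat_adjoint W * M * W"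
  have N: "N \<in> carrier_mat (Suc n) (Suc n)"
    unfolding N_def by (intro carrier_matI) auto
  have Nd [simp]: "dim_row N = Suc n" "dim_col N = Suc n" using N by auto
  have adjN: "mat_adjoint N = N"
    by (simp add: N_def mat_adjoint_mult mult_mat_assoc_dim Suc.prems(2))
  have herm: "cnj (N $$ (j, i)) = N $$ (i, j)" if "i < Suc n" "j < Suc n" for i j
    using arg_cong[OF adjN, of "\<lambda>X. X $$ (i, j)"] that by simp
  have "col N 0 = mat_adjoint W *\<^sub>v (M *\<^sub>v col W 0)"
    by (simp add: N_def mult_mat_assoc_dim)
      (subst col_mult2[of _ "Suc n" "Suc n" _ "Suc n"]; simp add: W Suc.prems carrier_matI)+
  also have "M *\<^sub>v col W 0 = e \<cdot>\<^sub>v col W 0"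
    using Suc.prems(1) v by (simp add: W(3) mult_mat_vec smult_smult_assoc mult.commute)
  also have "mat_adjoint W *\<^sub>v (e \<cdot>\<^sub>v col W 0) = e \<cdot>\<^sub>v (mat_adjoint W *\<^sub>v col W 0)"
    using W(1) by (intro mult_mat_vec[of _ "Suc n" "Suc n"]) (auto intro: carrier_vecI)
  also have "mat_adjoint W *\<^sub>v col W 0 = col (mat_adjoint W * W) 0"
    using W(1) by (intro col_mult2[symmetric]) auto
  finally have col0: "col N 0 = e \<cdot>\<^sub>v unit_vec (Suc n) 0"
    by (simp add: W(2))
  have N0: "N $$ (i, 0) = (if i = 0 then e else 0)" if "i < Suc n" for i
    using arg_cong[OF col0, of "\<lambda>x. x $ i"] that by auto
  have N0': "N $$ (0, i) = (if i = 0 then e else 0)" if "i < Suc n" for i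
    using herm[of 0 i] N0[OF that] N0[of 0] that by (auto split: if_splits)
  define N' where "N' = mat n n (\<lambda>(i, j). N $$ (Suc i, Suc j))"
  have N': "N' \<in> carrier_mat n n" "mat_adjoint N' = N'"
    using herm by (auto simp: N'_def intro!: eq_matI)
  obtain V f where V: "V \<in> carrier_mat n n" "mat_adjoint V * V = 1\<^sub>m n"
    "mat_adjoint V * N' * V = mat_diag n f"
    using Suc.IH[OF N'] by blast
  \<comment> \<open>\<open>1 \<oplus> V\<close> diagonalizes the lower block and leaves the
    eigenvalue \<open>e\<close> alone, which \<open>case_nat e f\<close> puts in front of the
    others.\<close>
  define U where "U = four_block_mat (1\<^sub>m 1) (0\<^sub>m 1 n) (0\<^sub>m n 1) V"
  have U: "U \<in> carrier_mat (Suc n) (Suc n)"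
    using V(1) four_block_carrier_mat[of "1\<^sub>m 1" 1 1 V n n] by (simp add: U_def)
  have Ud [simp]: "dim_row U = Suc n" "dim_col U = Suc n" using U by auto
  have adjU: "mat_adjoint U = four_block_mat (1\<^sub>m 1) (0\<^sub>m 1 n) (0\<^sub>m n 1) (mat_adjoint V)"
    using V(1) by (intro eq_matI) (auto simp: U_def)
  have Nblock: "N = four_block_mat (mat_diag 1 (\<lambda>_. e)) (0\<^sub>m 1 n) (0\<^sub>m n 1) N'"
    using N0 N0' by (intro eq_matI) (auto simp: N'_def mat_diag_def)
  have UU: "mat_adjoint U * U = 1\<^sub>m (Suc n)"
    unfolding adjU unfolding U_def
    using V by (subst mult_four_block_mat[of _ 1 1 _ n _ n _ _ 1 _ n]) auto
  have "mat_adjoint U * N * U = four_block_mat (mat_diag 1 (\<lambda>_. e)) (0\<^sub>m 1 n) (0\<^sub>m n 1) (mat_diag n f)"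
  proof -
    have "mat_adjoint U * N = four_block_mat (mat_diag 1 (\<lambda>_. e)) (0\<^sub>m 1 n) (0\<^sub>m n 1) (mat_adjoint V * N')"
      unfolding adjU Nblock
      using V(1) N'(1) by (subst mult_four_block_mat[of _ 1 1 _ n _ n _ _ 1 _ n]) auto
    then show ?thesis
      unfolding U_def V(3)[symmetric]
      using V(1) N'(1) by (simp, subst mult_four_block_mat[of _ 1 1 _ n _ n _ _ 1 _ n]) auto
  qed
  also have "\<dots> = mat_diag (Suc n) (case_nat e f)"
    by (intro eq_matI) (auto simp: mat_diag_def split: nat.splits)
  finally have diag: "mat_adjoint U * N * U = mat_diag (Suc n) (case_nat e f)" .
  have "mat_adjoint (W * U) * (W * U) = mat_adjoint U * (mat_adjoint W * W) * U"
    by (simp add: mat_adjoint_mult mult_mat_assoc_dim)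
  then have 1: "mat_adjoint (W * U) * (W * U) = 1\<^sub>m (Suc n)"
    using U by (simp add: W(2) UU)
  have 2: "mat_adjoint (W * U) * M * (W * U) = mat_diag (Suc n) (case_nat e f)"
    unfolding diag[symmetric] N_def by (simp add: mat_adjoint_mult mult_mat_assoc_dim)
  show ?case using 1 2 W(1) U by (intro exI[of _ "W * U"] exI conjI) auto
qed

section \<open>Square roots and factorizations\<close>

lemma gram_diag_entry:
  fixes M :: "complex mat"
  assumes "M \<in> carrier_mat m n" "i < n"
  shows "(mat_adjoint M * M) $$ (i, i) = complex_of_real (\<Sum>k<m. (cmod (M $$ (k, i)))\<^sup>2)"
proof -
  have "(mat_adjoint M * M) $$ (i, i) = (\<Sum>k<m. cnj (M $$ (k, i)) * M $$ (k, i))"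
    using assms by (simp add: scalar_prod_def lessThan_atLeast0)
  also have "\<dots> = complex_of_real (\<Sum>k<m. (cmod (M $$ (k, i)))\<^sup>2)"
    by (simp add: complex_norm_square mult.commute del: of_real_power)
  finally show ?thesis .
qed

text \<open>The diagonal entry is the squared norm of column \<open>j\<close>.\<close>

lemma gram_diag_entry_eq_0:
  fixes M :: "complex mat"
  assumes "M \<in> carrier_mat m n" "j < n" "(mat_adjoint M * M) $$ (j, j) = 0" "i < m"
  shows "M $$ (i, j) = 0"
proof -
  have "(\<Sum>k<m. (cmod (M $$ (k, j)))\<^sup>2) = 0"
    using assms(3) unfolding gram_diag_entry[OF assms(1,2)] of_real_eq_0_iff .
  then show ?thesis using assms(4) by (simp add: sum_nonneg_eq_0_iff)
qed

lemma mat_diag_cong: "(\<And>i. i < n \<Longrightarrow> f i = g i) \<Longrightarrow> mat_diag n f = mat_diag n g"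
  by (rule eq_matI) (auto simp: mat_diag_def)

text \<open>The eigenvalues are the diagonal entries of the psd matrix \<open>V\<^sup>* M V\<close>,
  hence real and nonnegative; this is why \<open>g\<close> can be real-valued.\<close>

lemma psd_mat_diagonalization:
  fixes M :: "complex mat"
  assumes M: "psd_mat n M"
  obtains V g where "V \<in> carrier_mat n n" "mat_adjoint V * V = 1\<^sub>m n" "V * mat_adjoint V = 1\<^sub>m n"
    "\<And>i. i < n \<Longrightarrow> 0 \<le> g i"
    "mat_adjoint V * M * V = mat_diag n (\<lambda>i. complex_of_real (g i))"
    "M = V * mat_diag n (\<lambda>i. complex_of_real (g i)) * mat_adjoint V"
proof -
  obtain V f where V: "V \<in> carrier_mat n n" "mat_adjoint V * V = 1\<^sub>m n"
    and f: "mat_adjoint V * M * V = mat_diag n f"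
    using hermitian_diagonalization[OF psd_matD(1,2)[OF M]] by blast
  note [simp del] = assoc_mult_mat
  note [simp] = psd_matD(2-4)[OF M]
  have Vd [simp]: "dim_row V = n" "dim_col V = n" using V by auto
  have VV: "V * mat_adjoint V = 1\<^sub>m n"
    by (rule mat_mult_left_right_inverse[OF mat_adjoint_carrier[OF V(1)] V(1) V(2)])
  have pos: "0 \<le> f i" if "i < n" for i
    using psd_mat_diag_entry[OF psd_mat_congruence[OF M V(1)] that] that
    by (simp add: f mat_diag_def)
  define g where "g i = Re (f i)" for i
  have fg: "mat_diag n f = mat_diag n (\<lambda>i. complex_of_real (g i))"
    using pos by (intro eq_matI) (auto simp: mat_diag_def g_def less_eq_complex_def complex_eq_iff)
  have "M = (V * mat_adjoint V) * M * (V * mat_adjoint V)"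
    by (simp add: VV)
  also have "\<dots> = V * (mat_adjoint V * M * V) * mat_adjoint V"
    by (simp add: mult_mat_assoc_dim)
  finally have "M = V * mat_diag n (\<lambda>i. complex_of_real (g i)) * mat_adjoint V"
    unfolding f fg .
  with V VV f fg pos show thesis
    by (intro that[of V g]) (auto simp: g_def less_eq_complex_def)
qed

text \<open>The witness is \<open>g\<^sup>1\<^sup>/\<^sup>2 V\<^sup>*\<close>, where
  \<open>M = V g V\<^sup>*\<close>. A Gram factor turns questions about psd matrices into questions
  about norms of columns.\<close>

lemma psd_mat_factor:
  fixes M :: "complex mat"
  assumes M: "psd_mat n M"
  obtains R where "R \<in> carrier_mat n n" "M = mat_adjoint R * R"
proof -
  obtain V g where V: "V \<in> carrier_mat n n" and g: "\<And>i. i < n \<Longrightarrow> 0 \<le> g i"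
    and eq: "M = V * mat_diag n (\<lambda>i. complex_of_real (g i)) * mat_adjoint V"
    using psd_mat_diagonalization[OF M] by metis
  note [simp del] = assoc_mult_mat mat_diag_diag
  have Vd [simp]: "dim_row V = n" "dim_col V = n" using V by auto
  define L where "L = mat_diag n (\<lambda>i. complex_of_real (sqrt (g i)))"
  have Ld [simp]: "dim_row L = n" "dim_col L = n" by (simp_all add: L_def)
  have LL: "mat_adjoint L * L = mat_diag n (\<lambda>i. complex_of_real (g i))"
    using g by (simp add: L_def mat_diag_diag flip: of_real_mult) (auto simp: mat_diag_def)
  have "mat_adjoint (L * mat_adjoint V) * (L * mat_adjoint V) = V * (mat_adjoint L * L) * mat_adjoint V"
    by (simp add: mat_adjoint_mult mult_mat_assoc_dim)
  then show thesis
    using eq V by (intro that[of "L * mat_adjoint V"]) (auto simp: LL intro!: carrier_matI)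
qed

section \<open>Consequences of the Gram factor\<close>

lemma mat_trace_gram_nonneg: "0 \<le> mat_trace (mat_adjoint M * M :: complex mat)"
  using gram_diag_entry[of M "dim_row M" "dim_col M"]
  by (auto simp: mat_trace_def less_eq_complex_def intro!: sum_nonneg simp del: index_mult_mat(1))

text \<open>With \<open>P = R\<^sup>* R\<close> and \<open>Q = S\<^sup>* S\<close>, cyclicity makes
  the trace the squared Frobenius norm of \<open>R S\<^sup>*\<close>.\<close>

lemma mat_trace_psd_mult_nonneg:
  fixes P Q :: "complex mat"
  assumes P: "psd_mat n P" and Q: "psd_mat n Q"
  shows "0 \<le> mat_trace (P * Q)"
proof -
  obtain R where R: "R \<in> carrier_mat n n" "P = mat_adjoint R * R" using psd_mat_factor[OF P] by blast
  obtain S where S: "S \<in> carrier_mat n n" "Q = mat_adjoint S * S" using psd_mat_factor[OF Q] by blast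
  note [simp del] = assoc_mult_mat
  have [simp]: "dim_row R = n" "dim_col R = n" "dim_row S = n" "dim_col S = n" using R S by auto
  have "mat_trace (P * Q) = mat_trace ((mat_adjoint R * (R * mat_adjoint S)) * S)"
    by (simp add: R(2) S(2) mult_mat_assoc_dim)
  also have "\<dots> = mat_trace (mat_adjoint (R * mat_adjoint S) * (R * mat_adjoint S))"
    by (subst mat_trace_mult_comm) (simp_all add: mat_adjoint_mult mult_mat_assoc_dim)
  finally show ?thesis using mat_trace_gram_nonneg by simp
qed

text \<open>With \<open>M = R\<^sup>* R\<close>, the vanishing diagonal entries are the squared
  norms of the columns of \<open>R X\<close>; so \<open>R X = 0\<close> and
  \<open>M X = R\<^sup>* R X = 0\<close>.\<close>

lemma psd_mat_kernel:
  fixes M :: "complex mat"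
  assumes M: "psd_mat n M" and X: "X \<in> carrier_mat n m"
    and 0: "\<And>i. i < m \<Longrightarrow> (mat_adjoint X * M * X) $$ (i, i) = 0"
  shows "M * X = 0\<^sub>m n m"
proof -
  obtain R where R: "R \<in> carrier_mat n n" "M = mat_adjoint R * R" using psd_mat_factor[OF M] by blast
  note [simp del] = assoc_mult_mat
  have [simp]: "dim_row R = n" "dim_col R = n" "dim_row X = n" "dim_col X = m" using R X by auto
  have "mat_adjoint X * M * X = mat_adjoint (R * X) * (R * X)"
    by (simp add: R(2) mat_adjoint_mult mult_mat_assoc_dim)
  then have "(R * X) $$ (i, j) = 0" if "i < n" "j < m" for i j
    using gram_diag_entry_eq_0[of "R * X" n m j i] 0[OF that(2)] that R X by simp
  then have "R * X = 0\<^sub>m n m"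
    by (intro eq_matI) (auto simp del: index_mult_mat(1))
  then show ?thesis
    using R by (simp add: mult_mat_assoc_dim)
qed

text \<open>With the polar decomposition \<open>\<Psi> = U \<bar>\<Psi>\<bar>\<close>, take \<open>C = U \<bar>\<Psi>\<bar>\<^sup>1\<^sup>/\<^sup>2\<close> and \<open>D = \<bar>\<Psi>\<bar>\<^sup>1\<^sup>/\<^sup>2\<close>, written in
  an eigenbasis of \<open>\<Psi>\<^sup>* \<Psi>\<close>.\<close>

lemma balanced_factorization:
  fixes \<Psi> :: "complex mat"
  assumes \<Psi>: "\<Psi> \<in> carrier_mat d e"
  obtains C D where "C \<in> carrier_mat d e" "D \<in> carrier_mat e e"
    "C * mat_adjoint D = \<Psi>" "mat_adjoint C * C = mat_adjoint D * D"
proof -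
  obtain V g where V: "V \<in> carrier_mat e e" "mat_adjoint V * V = 1\<^sub>m e" "V * mat_adjoint V = 1\<^sub>m e"
    and g: "\<And>i. i < e \<Longrightarrow> 0 \<le> g i"
    and diag: "mat_adjoint V * (mat_adjoint \<Psi> * \<Psi>) * V = mat_diag e (\<lambda>i. complex_of_real (g i))"
    using psd_mat_diagonalization[OF psd_mat_gram[OF \<Psi>]] by metis
  note [simp del] = assoc_mult_mat mat_diag_diag
  have [simp]: "dim_row V = e" "dim_col V = e" "dim_row \<Psi> = d" "dim_col \<Psi> = e" using V \<Psi> by auto
  \<comment> \<open>The \<open>g i\<close> are the squared singular values of \<open>\<Psi>\<close>,
    so \<open>q i\<close> is the square root of a singular value.\<close>
  define q where "q i = sqrt (sqrt (g i))" for i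
  define L where "L = mat_diag e (\<lambda>i. complex_of_real (q i))"
  \<comment> \<open>Since \<open>inverse 0 = 0\<close>, this is the pseudoinverse of
    \<open>L\<close>.\<close>
  define L' where "L' = mat_diag e (\<lambda>i. complex_of_real (inverse (q i)))"
  have [simp]: "dim_row L = e" "dim_col L = e" "dim_row L' = e" "dim_col L' = e"
    "mat_adjoint L = L" "mat_adjoint L' = L'"
    by (simp_all add: L_def L'_def)
  have q4: "g i = q i * q i * (q i * q i)" if "i < e" for i
    using g[OF that] by (simp add: q_def)
  have VL: "mat_adjoint V * (V * X) = X" if "dim_row X = e" for X
    using that by (simp add: mult_mat_assoc_dim[symmetric] V(2))
  have "L' * mat_diag e (\<lambda>i. complex_of_real (g i)) * L' = L * L"
    unfolding L_def L'_def mat_diag_diag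
    by (rule mat_diag_cong) (simp add: q4 field_simps)
  then have "mat_adjoint (\<Psi> * V * L') * (\<Psi> * V * L') = mat_adjoint (V * L) * (V * L)"
    unfolding diag[symmetric] by (simp add: mat_adjoint_mult mult_mat_assoc_dim VL)
  \<comment> \<open>If \<open>q j = 0\<close>, the \<open>j\<close>-th column of
    \<open>\<Psi> V\<close> is zero, so the zero on the diagonal of \<open>L' L\<close> does no harm
    there.\<close>
  moreover have "\<Psi> * V * (L' * L) = \<Psi> * V"
  proof (rule eq_matI)
    fix i j assume "i < dim_row (\<Psi> * V)" "j < dim_col (\<Psi> * V)"
    then have ij: "i < d" "j < e" by auto
    have "(\<Psi> * V) $$ (i, j) = 0" if "q j = 0"
    proof (rule gram_diag_entry_eq_0[of _ d e])
      have "mat_adjoint (\<Psi> * V) * (\<Psi> * V) = mat_diag e (\<lambda>i. complex_of_real (g i))"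
        unfolding diag[symmetric] by (simp add: mat_adjoint_mult mult_mat_assoc_dim)
      then show "(mat_adjoint (\<Psi> * V) * (\<Psi> * V)) $$ (j, j) = 0"
        using ij that by (simp add: mat_diag_def q4)
    qed (use ij \<Psi> V in auto)
    then have "(\<Psi> * V) $$ (i, j) * (complex_of_real (inverse (q j)) * complex_of_real (q j))
        = (\<Psi> * V) $$ (i, j)"
      by (cases "q j = 0") auto
    then show "(\<Psi> * V * (L' * L)) $$ (i, j) = (\<Psi> * V) $$ (i, j)"
      using ij \<Psi> V(1) unfolding L_def L'_def mat_diag_diag
      by (subst mat_diag_mult_right[of _ d]) auto
  qed simp_all
  then have "\<Psi> * V * L' * mat_adjoint (V * L) = \<Psi> * V * mat_adjoint V"
    by (simp add: mat_adjoint_mult mult_mat_assoc_dim) (simp add: mult_mat_assoc_dim[symmetric])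
  ultimately show thesis
    by (intro that[of "\<Psi> * V * L'" "V * L"]) (auto simp: mult_mat_assoc_dim V(3) intro!: carrier_matI)
qed

text \<open>The witnesses are \<open>W = V \<kappa>\<^sup>-\<^sup>1\<^sup>/\<^sup>2\<close>, \<open>\<Psi> = \<kappa>\<close> and the projection \<open>Z\<close> onto the kernel of
  \<open>\<kappa>\<close>, where \<open>K = V \<kappa> V\<^sup>*\<close> with \<open>\<kappa>\<close> diagonal.\<close>

lemma psd_mat_normalization:
  fixes K :: "complex mat"
  assumes K: "psd_mat d K"
  obtains W \<Psi> Z where "W \<in> carrier_mat d d" "\<Psi> \<in> carrier_mat d d" "psd_mat d Z"
    "mat_adjoint \<Psi> = \<Psi>" "mat_adjoint W * K * W + Z = 1\<^sub>m d" "\<Psi> * Z = 0\<^sub>m d d"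
    "K * (W * \<Psi> * mat_adjoint W) = K" "mat_trace (\<Psi> * \<Psi>) = mat_trace (K * K)"
proof -
  obtain V g where V: "V \<in> carrier_mat d d" "mat_adjoint V * V = 1\<^sub>m d" "V * mat_adjoint V = 1\<^sub>m d"
    and g: "\<And>i. i < d \<Longrightarrow> 0 \<le> g i"
    and diag: "mat_adjoint V * K * V = mat_diag d (\<lambda>i. complex_of_real (g i))"
    and eq: "K = V * mat_diag d (\<lambda>i. complex_of_real (g i)) * mat_adjoint V"
    using psd_mat_diagonalization[OF K] by metis
  note [simp del] = assoc_mult_mat mat_diag_diag
  note [simp] = psd_matD(2-4)[OF K]
  have [simp]: "dim_row V = d" "dim_col V = d" using V by auto
  \<comment> \<open>With \<open>inverse 0 = 0\<close>, this inverts the square root of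
    \<open>\<Psi>\<close> on the range of \<open>\<Psi>\<close> and vanishes on its kernel.\<close>
  define L where "L = mat_diag d (\<lambda>i. complex_of_real (inverse (sqrt (g i))))"
  define \<Psi> where "\<Psi> = mat_diag d (\<lambda>i. complex_of_real (g i))"
  define Z where "Z = mat_diag d (\<lambda>i. complex_of_real (if g i = 0 then 1 else 0))"
  have [simp]: "dim_row L = d" "dim_col L = d" "mat_adjoint L = L"
    "dim_row \<Psi> = d" "dim_col \<Psi> = d" "mat_adjoint \<Psi> = \<Psi>" "dim_row Z = d" "dim_col Z = d"
    by (simp_all add: L_def \<Psi>_def Z_def)
  have VL: "mat_adjoint V * (V * X) = X" if "dim_row X = d" for X
    using that by (simp add: mult_mat_assoc_dim[symmetric] V(2))
  have inv: "inverse (sqrt (g i)) * g i * inverse (sqrt (g i)) = (if g i = 0 then 0 else 1)"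
    if "i < d" for i using g[OF that] by (auto simp: field_simps)
  \<comment> \<open>The projection onto the range of \<open>\<Psi>\<close>, complementary to
    \<open>Z\<close>.\<close>
  have L\<Psi>L: "L * \<Psi> * L = mat_diag d (\<lambda>i. complex_of_real (if g i = 0 then 0 else 1))"
    unfolding L_def \<Psi>_def mat_diag_diag of_real_mult[symmetric]
    by (rule mat_diag_cong) (simp only: inv)
  have psdZ: "psd_mat d Z"
  proof -
    \<comment> \<open>A Hermitian idempotent is its own Gram matrix.\<close>
    have "mat_adjoint Z * Z = Z"
      by (auto simp: Z_def mat_diag_diag) (auto simp: mat_diag_def intro!: eq_matI)
    then show ?thesis using psd_mat_gram[of Z d d] by (metis Z_def mat_diag_dim)
  qed
  have "mat_adjoint (V * L) * K * (V * L) = L * \<Psi> * L"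
    unfolding \<Psi>_def diag[symmetric] by (simp add: mat_adjoint_mult mult_mat_assoc_dim)
  then have 1: "mat_adjoint (V * L) * K * (V * L) + Z = 1\<^sub>m d"
    unfolding L\<Psi>L by (auto simp: Z_def mat_diag_def intro!: eq_matI)
  have 2: "\<Psi> * Z = 0\<^sub>m d d"
    by (auto simp: \<Psi>_def Z_def mat_diag_diag) (auto simp: mat_diag_def intro!: eq_matI)
  have "\<Psi> * (L * \<Psi> * L) = \<Psi>"
    unfolding L\<Psi>L unfolding \<Psi>_def mat_diag_diag by (auto simp: mat_diag_def intro!: eq_matI)
  then have \<Psi>\<Psi>: "\<Psi> * (L * (\<Psi> * (L * X))) = \<Psi> * X" if "dim_row X = d" for X
    using that by (metis (no_types, lifting) \<open>dim_col L = d\<close> \<open>dim_col \<Psi> = d\<close> \<open>dim_row L = d\<close>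
      \<open>dim_row \<Psi> = d\<close> index_mult_mat(2,3) mult_mat_assoc_dim)
  \<comment> \<open>Here \<open>W = V L\<close>, and \<open>W \<Psi> W\<^sup>*\<close> is the
    projection onto the range of \<open>K\<close>.\<close>
  have 3: "K * (V * L * \<Psi> * mat_adjoint (V * L)) = K"
    unfolding eq \<Psi>_def[symmetric] by (simp add: mat_adjoint_mult mult_mat_assoc_dim VL \<Psi>\<Psi>)
  have "K * K = (V * (\<Psi> * \<Psi>)) * mat_adjoint V"
    unfolding eq \<Psi>_def[symmetric] by (simp add: mult_mat_assoc_dim VL)
  then have "mat_trace (K * K) = mat_trace (mat_adjoint V * (V * (\<Psi> * \<Psi>)))"
    by (subst mat_trace_mult_comm[symmetric]) auto
  then have 4: "mat_trace (\<Psi> * \<Psi>) = mat_trace (K * K)"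
    by (simp add: VL)
  show thesis
    by (rule that[OF _ _ psdZ _ 1 2 3 4]) (auto intro!: carrier_matI)
qed

section \<open>Sums, tensors and real forms\<close>

lemma cquadratic_form_conv_sum:
  assumes "M \<in> carrier_mat d d" "v \<in> carrier_vec d"
  shows "(M *\<^sub>v v) \<bullet>c v = (\<Sum>i<d. \<Sum>j<d. M $$ (i, j) * v $ j * conjugate (v $ i))"
  using assms by (simp add: scalar_prod_def sum_distrib_right lessThan_atLeast0)

lemma index_mult3_mat:
  assumes "X \<in> carrier_mat m d" "M \<in> carrier_mat d e" "Y \<in> carrier_mat e n" "i < m" "j < n"
  shows "(X * M * Y) $$ (i, j) = (\<Sum>l<e. \<Sum>k<d. X $$ (i, k) * M $$ (k, l) * Y $$ (l, j))"
  using assms by (simp add: scalar_prod_def sum_distrib_right lessThan_atLeast0 del: assoc_mult_mat)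

text \<open>The entrywise sum that occurs in \<open>povm\<close>; the explicit dimension makes the
  empty sum the zero matrix of that size.\<close>

definition mat_sum :: "nat \<Rightarrow> 'i set \<Rightarrow> ('i \<Rightarrow> 'a :: comm_monoid_add mat) \<Rightarrow> 'a mat" where
  "mat_sum d I P = mat d d (\<lambda>ij. \<Sum>i\<in>I. P i $$ ij)"

lemma mat_sum_carrier [simp]: "mat_sum d I P \<in> carrier_mat d d"
  and mat_sum_dims [simp]: "dim_row (mat_sum d I P) = d" "dim_col (mat_sum d I P) = d"
  by (simp_all add: mat_sum_def)

lemma index_mat_sum [simp]:
  "i < d \<Longrightarrow> j < d \<Longrightarrow> mat_sum d I P $$ (i, j) = (\<Sum>x\<in>I. P x $$ (i, j))"
  by (simp add: mat_sum_def)

lemma povm_conv_mat_sum: "povm d A X \<longleftrightarrow> (\<forall>a\<in>A. psd_mat d (X a)) \<and> mat_sum d A X = 1\<^sub>m d"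
  by (simp add: povm_def mat_sum_def)

lemma mat_sum_congruence:
  fixes P :: "'i \<Rightarrow> 'a :: comm_semiring_0 mat"
  assumes "X \<in> carrier_mat m d" "Y \<in> carrier_mat d m" and P: "\<And>x. x \<in> I \<Longrightarrow> P x \<in> carrier_mat d d"
  shows "X * mat_sum d I P * Y = mat_sum m I (\<lambda>x. X * P x * Y)"
proof (rule eq_matI)
  fix i j assume "i < dim_row (mat_sum m I (\<lambda>x. X * P x * Y))" "j < dim_col (mat_sum m I (\<lambda>x. X * P x * Y))"
  then have ij: "i < m" "j < m" by auto
  have "(X * mat_sum d I P * Y) $$ (i, j)
      = (\<Sum>l<d. \<Sum>k<d. \<Sum>x\<in>I. X $$ (i, k) * P x $$ (k, l) * Y $$ (l, j))"
    by (subst index_mult3_mat[of _ m d _ d _ m])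
      (simp_all add: assms(1,2) ij sum_distrib_left sum_distrib_right)
  also have "\<dots> = (\<Sum>l<d. \<Sum>x\<in>I. \<Sum>k<d. X $$ (i, k) * P x $$ (k, l) * Y $$ (l, j))"
    by (intro sum.cong refl sum.swap)
  also have "\<dots> = (\<Sum>x\<in>I. \<Sum>l<d. \<Sum>k<d. X $$ (i, k) * P x $$ (k, l) * Y $$ (l, j))"
    by (rule sum.swap)
  also have "\<dots> = (\<Sum>x\<in>I. (X * P x * Y) $$ (i, j))"
    by (intro sum.cong refl index_mult3_mat[symmetric, of _ m d _ d _ m]) (use assms ij in auto)
  finally show "(X * mat_sum d I P * Y) $$ (i, j) = mat_sum m I (\<lambda>x. X * P x * Y) $$ (i, j)"
    using ij by simp
qed (use assms(1,2) in auto)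

lemma mat_trace_mat_sum_mult:
  fixes P :: "'i \<Rightarrow> 'a :: comm_semiring_0 mat"
  assumes P: "\<And>x. x \<in> I \<Longrightarrow> P x \<in> carrier_mat d d" and Q: "\<And>y. y \<in> J \<Longrightarrow> Q y \<in> carrier_mat d d"
  shows "mat_trace (mat_sum d I P * mat_sum d J Q) = (\<Sum>x\<in>I. \<Sum>y\<in>J. mat_trace (P x * Q y))"
proof -
  have "mat_trace (mat_sum d I P * mat_sum d J Q)
      = (\<Sum>i<d. \<Sum>j<d. \<Sum>x\<in>I. \<Sum>y\<in>J. P x $$ (i, j) * Q y $$ (j, i))"
    by (subst mat_trace_mult[of _ d d]) (simp_all add: sum_product)
  also have "\<dots> = (\<Sum>i<d. \<Sum>x\<in>I. \<Sum>j<d. \<Sum>y\<in>J. P x $$ (i, j) * Q y $$ (j, i))"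
    by (intro sum.cong refl sum.swap)
  also have "\<dots> = (\<Sum>x\<in>I. \<Sum>i<d. \<Sum>j<d. \<Sum>y\<in>J. P x $$ (i, j) * Q y $$ (j, i))"
    by (rule sum.swap)
  also have "\<dots> = (\<Sum>x\<in>I. \<Sum>i<d. \<Sum>y\<in>J. \<Sum>j<d. P x $$ (i, j) * Q y $$ (j, i))"
    by (intro sum.cong refl sum.swap)
  also have "\<dots> = (\<Sum>x\<in>I. \<Sum>y\<in>J. \<Sum>i<d. \<Sum>j<d. P x $$ (i, j) * Q y $$ (j, i))"
    by (intro sum.cong refl sum.swap)
  also have "\<dots> = (\<Sum>x\<in>I. \<Sum>y\<in>J. mat_trace (P x * Q y))"
    by (intro sum.cong refl mat_trace_mult[symmetric] P Q)
  finally show ?thesis .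
qed

section \<open>Psd matrices under sums and transposition\<close>

lemma psd_mat_entry_conjugate:
  assumes "psd_mat d M" "i < d" "j < d"
  shows "conjugate (M $$ (i, j)) = M $$ (j, i)"
  using arg_cong[OF psd_matD(2)[OF assms(1)], of "\<lambda>X. X $$ (j, i)"] assms psd_matD(3,4)[OF assms(1)]
  by simp

lemma psd_mat_sum:
  fixes P :: "'i \<Rightarrow> 'a :: conjugatable_ordered_field mat"
  assumes P: "\<And>x. x \<in> I \<Longrightarrow> psd_mat d (P x)"
  shows "psd_mat d (mat_sum d I P)"
  unfolding psd_mat_def
proof (intro conjI ballI)
  show "mat_adjoint (mat_sum d I P) = mat_sum d I P"
  proof (rule eq_matI)
    fix i j assume "i < dim_row (mat_sum d I P)" "j < dim_col (mat_sum d I P)"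
    then show "mat_adjoint (mat_sum d I P) $$ (i, j) = mat_sum d I P $$ (i, j)"
      using psd_mat_entry_conjugate[OF P, of _ j i]
      by (cases "finite I") (simp_all add: sum_conjugate)
  qed simp_all
  fix v :: "'a vec" assume v: "v \<in> carrier_vec d"
  have "(mat_sum d I P *\<^sub>v v) \<bullet>c v
      = (\<Sum>i<d. \<Sum>j<d. \<Sum>x\<in>I. P x $$ (i, j) * v $ j * conjugate (v $ i))"
    by (subst cquadratic_form_conv_sum[of _ d]) (simp_all add: v sum_distrib_right)
  also have "\<dots> = (\<Sum>i<d. \<Sum>x\<in>I. \<Sum>j<d. P x $$ (i, j) * v $ j * conjugate (v $ i))"
    by (intro sum.cong refl sum.swap)
  also have "\<dots> = (\<Sum>x\<in>I. \<Sum>i<d. \<Sum>j<d. P x $$ (i, j) * v $ j * conjugate (v $ i))"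
    by (rule sum.swap)
  also have "\<dots> = (\<Sum>x\<in>I. (P x *\<^sub>v v) \<bullet>c v)"
    by (intro sum.cong refl cquadratic_form_conv_sum[symmetric] psd_matD(1)[OF P] v)
  also have "0 \<le> \<dots>"
    by (intro sum_nonneg psd_matD(5)[OF P] v)
  finally show "0 \<le> (mat_sum d I P *\<^sub>v v) \<bullet>c v" .
qed simp

text \<open>The diagonal entries of the matrices \<open>X\<^sup>* P x X\<close> are nonnegative and
  add up to zero, so each one vanishes and \<open>psd_mat_kernel\<close> applies.\<close>

lemma psd_mat_sum_kernel:
  fixes P :: "'i \<Rightarrow> complex mat"
  assumes P: "\<And>x. x \<in> I \<Longrightarrow> psd_mat d (P x)" and X: "X \<in> carrier_mat d m"
    and I: "finite I" "x \<in> I" and 0: "mat_sum d I P * X = 0\<^sub>m d m"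
  shows "P x * X = 0\<^sub>m d m"
proof (rule psd_mat_kernel[OF P X])
  fix i assume i: "i < m"
  note nonneg = psd_mat_diag_entry[OF psd_mat_congruence[OF P X] i]
  have [simp]: "dim_row X = d" "dim_col X = m" using X by auto
  have "(\<Sum>x\<in>I. (mat_adjoint X * P x * X) $$ (i, i)) = (mat_adjoint X * mat_sum d I P * X) $$ (i, i)"
    using i by (subst mat_sum_congruence[of _ m])
      (auto simp: X psd_matD(1)[OF P] simp del: index_mult_mat(1) assoc_mult_mat)
  also have "\<dots> = (mat_adjoint X * (mat_sum d I P * X)) $$ (i, i)"
    by (subst mult_mat_assoc_dim) simp_all
  also have "\<dots> = 0"
    unfolding 0 using i by simp
  finally show "(mat_adjoint X * P x * X) $$ (i, i) = 0"
    using nonneg I by (simp add: sum_nonneg_eq_0_iff del: index_mult_mat(1) assoc_mult_mat)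
qed (use I in auto)

text \<open>The quadratic form of the transpose at \<open>v\<close> is that of \<open>M\<close> at
  the conjugate of \<open>v\<close>.\<close>

lemma psd_mat_transpose:
  fixes M :: "complex mat"
  assumes M: "psd_mat d M"
  shows "psd_mat d (transpose_mat M)"
  unfolding psd_mat_def
proof (intro conjI ballI)
  note [simp] = psd_matD(3,4)[OF M]
  show "transpose_mat M \<in> carrier_mat d d" by (intro carrier_matI) simp_all
  show "mat_adjoint (transpose_mat M) = transpose_mat M"
    using psd_mat_entry_conjugate[OF M] by (intro eq_matI) auto
  fix v :: "complex vec" assume v: "v \<in> carrier_vec d"
  have "(transpose_mat M *\<^sub>v v) \<bullet>c v = (\<Sum>i<d. \<Sum>j<d. M $$ (j, i) * v $ j * cnj (v $ i))"
    by (subst cquadratic_form_conv_sum[of _ d]) (simp_all add: v psd_matD(1)[OF M])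
  also have "\<dots> = (\<Sum>j<d. \<Sum>i<d. M $$ (j, i) * cnj (v $ i) * v $ j)"
    by (subst sum.swap) (simp add: mult_ac)
  also have "\<dots> = (M *\<^sub>v conjugate v) \<bullet>c conjugate v"
    using v by (subst cquadratic_form_conv_sum[of _ d]) (simp_all add: psd_matD(1)[OF M])
  also have "0 \<le> \<dots>"
    using v by (intro psd_matD(5)[OF M]) simp
  finally show "0 \<le> (transpose_mat M *\<^sub>v v) \<bullet>c v" .
qed

lemma mat_sum_transpose:
  "(\<And>x. x \<in> I \<Longrightarrow> P x \<in> carrier_mat d d) \<Longrightarrow>
    mat_sum d I (\<lambda>x. transpose_mat (P x)) = transpose_mat (mat_sum d I P)"
  by (intro eq_matI) (auto intro!: sum.cong index_transpose_mat(1))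

section \<open>Tensors as matrices\<close>

lemma sum_lessThan_mult:
  "(\<Sum>p<d * e. f p) = (\<Sum>i<d. \<Sum>j<e. f (i * e + j))" for d e :: nat
proof -
  have "(\<Sum>p<d * e. f p) = (\<Sum>i<d. \<Sum>p\<in>{i * e..<i * e + e}. f p)"
    by (rule sum.nat_group[symmetric])
  also have "\<dots> = (\<Sum>i<d. \<Sum>j<e. f (i * e + j))"
  proof (rule sum.cong[OF refl])
    fix i
    show "(\<Sum>p\<in>{i * e..<i * e + e}. f p) = (\<Sum>j<e. f (i * e + j))"
      using sum.shift_bounds_nat_ivl[of f 0 "i * e" e] by (simp add: lessThan_atLeast0 add.commute)
  qed
  finally show ?thesis .
qed

text \<open>The inverse of row-by-row vectorization \<open>vec\<close>, in the index order of
  \<open>kronecker\<close>.\<close>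

definition mat_of_tensor :: "nat \<Rightarrow> nat \<Rightarrow> 'a vec \<Rightarrow> 'a mat" where
  "mat_of_tensor d e \<psi> = mat d e (\<lambda>(i, j). \<psi> $ (i * e + j))"

lemma mat_of_tensor_carrier [simp]: "mat_of_tensor d e \<psi> \<in> carrier_mat d e"
  by (simp add: mat_of_tensor_def)

lemma tensor_index_less: "i < d \<Longrightarrow> j < e \<Longrightarrow> i * e + j < d * (e :: nat)"
  using mult_le_mono1[of "Suc i" d e] by simp

text \<open>This is \<open>(X \<otimes> Y) vec \<Psi> = vec (X \<Psi> Y\<^sup>T)\<close>, paired
  with \<open>vec \<Psi>\<close>. It replaces tensor products by traces of matrix products.\<close>

lemma kronecker_quadratic_form:
  fixes X Y :: "complex mat"
  assumes X: "X \<in> carrier_mat d d" and Y: "Y \<in> carrier_mat e e" and \<psi>: "\<psi> \<in> carrier_vec (d * e)"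
  shows "(kronecker X Y *\<^sub>v \<psi>) \<bullet>c \<psi>
    = mat_trace (mat_adjoint (mat_of_tensor d e \<psi>) * (X * mat_of_tensor d e \<psi> * transpose_mat Y))"
proof -
  have K: "kronecker X Y \<in> carrier_mat (d * e) (d * e)"
    using X Y by (intro carrier_matI) (auto simp: kronecker_def)
  have entry: "kronecker X Y $$ (i * e + j, k * e + l) = X $$ (i, k) * Y $$ (j, l)"
    if "i < d" "j < e" "k < d" "l < e" for i j k l
    using X Y that tensor_index_less[of i d j e] tensor_index_less[of k d l e]
    by (simp add: kronecker_def)
  define \<Psi> where "\<Psi> = mat_of_tensor d e \<psi>"
  have \<Psi>: "\<Psi> \<in> carrier_mat d e" by (simp add: \<Psi>_def)
  have \<Psi>_entry: "\<Psi> $$ (i, j) = \<psi> $ (i * e + j)" if "i < d" "j < e" for i j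
    using that by (simp add: \<Psi>_def mat_of_tensor_def)
  have "(kronecker X Y *\<^sub>v \<psi>) \<bullet>c \<psi> = (\<Sum>i<d. \<Sum>j<e. \<Sum>k<d. \<Sum>l<e.
      X $$ (i, k) * Y $$ (j, l) * \<Psi> $$ (k, l) * cnj (\<Psi> $$ (i, j)))"
    by (subst cquadratic_form_conv_sum[OF K \<psi>])
      (simp add: sum_lessThan_mult entry \<Psi>_entry)
  also have "\<dots> = (\<Sum>j<e. \<Sum>i<d. \<Sum>k<d. \<Sum>l<e.
      X $$ (i, k) * Y $$ (j, l) * \<Psi> $$ (k, l) * cnj (\<Psi> $$ (i, j)))"
    by (rule sum.swap)
  also have "\<dots> = (\<Sum>j<e. \<Sum>i<d. mat_adjoint \<Psi> $$ (j, i) * (X * \<Psi> * transpose_mat Y) $$ (i, j))"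
  proof (intro sum.cong refl)
    fix i j assume "i \<in> {..<d}" "j \<in> {..<e}"
    then have ij: "i < d" "j < e" by auto
    have "(X * \<Psi> * transpose_mat Y) $$ (i, j)
        = (\<Sum>l<e. \<Sum>k<d. X $$ (i, k) * \<Psi> $$ (k, l) * Y $$ (j, l))"
      using Y by (subst index_mult3_mat[OF X \<Psi> _ ij]) (auto simp: ij)
    then show "(\<Sum>k<d. \<Sum>l<e. X $$ (i, k) * Y $$ (j, l) * \<Psi> $$ (k, l) * cnj (\<Psi> $$ (i, j)))
        = mat_adjoint \<Psi> $$ (j, i) * (X * \<Psi> * transpose_mat Y) $$ (i, j)"
      using ij \<Psi> by (subst sum.swap) (simp add: sum_distrib_left mult_ac del: index_mult_mat(1) assoc_mult_mat)
  qed
  also have "\<dots> = mat_trace (mat_adjoint \<Psi> * (X * \<Psi> * transpose_mat Y))"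
    by (rule mat_trace_mult[symmetric]) (use X Y \<Psi> in auto)
  finally show ?thesis unfolding \<Psi>_def .
qed

text \<open>Vectorization carries the trace inner product to the inner product of vectors.\<close>

lemma tensor_norm:
  fixes \<psi> :: "complex vec"
  assumes "\<psi> \<in> carrier_vec (d * e)"
  shows "\<psi> \<bullet>c \<psi> = mat_trace (mat_adjoint (mat_of_tensor d e \<psi>) * mat_of_tensor d e \<psi>)"
proof -
  have "\<psi> \<bullet>c \<psi> = (\<Sum>i<d. \<Sum>j<e. \<psi> $ (i * e + j) * cnj (\<psi> $ (i * e + j)))"
    using assms tensor_index_less
    by (simp add: scalar_prod_def sum_lessThan_mult flip: lessThan_atLeast0)
  also have "\<dots> = (\<Sum>j<e. \<Sum>i<d. \<psi> $ (i * e + j) * cnj (\<psi> $ (i * e + j)))"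
    by (rule sum.swap)
  also have "\<dots> = mat_trace (mat_adjoint (mat_of_tensor d e \<psi>) * mat_of_tensor d e \<psi>)"
    by (subst mat_trace_mult[of _ e d]) (simp_all add: mat_of_tensor_def mult.commute)
  finally show ?thesis .
qed

section \<open>Passing between real and complex psd matrices\<close>

lemma psd_mat_of_real:
  fixes M :: "real mat"
  assumes M: "psd_mat d M"
  shows "psd_mat d (map_mat complex_of_real M)"
  unfolding psd_mat_def
proof (intro conjI ballI)
  note [simp] = psd_matD(3,4)[OF M]
  have sym: "M $$ (i, j) = M $$ (j, i)" if "i < d" "j < d" for i j
    using psd_mat_entry_conjugate[OF M that] by simp
  show C: "map_mat complex_of_real M \<in> carrier_mat d d" using psd_matD(1)[OF M] by simp
  show "mat_adjoint (map_mat complex_of_real M) = map_mat complex_of_real M"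
    using sym by (intro eq_matI) auto
  fix v :: "complex vec" assume v: "v \<in> carrier_vec d"
  define x y where "x = map_vec Re v" and "y = map_vec Im v"
  have xy: "x \<in> carrier_vec d" "y \<in> carrier_vec d" using v by (auto simp: x_def y_def)
  have eq: "(map_mat complex_of_real M *\<^sub>v v) \<bullet>c v = (\<Sum>i<d. \<Sum>j<d. complex_of_real (M $$ (i, j)) * v $ j * cnj (v $ i))"
    by (subst cquadratic_form_conv_sum[OF C v]) simp
  have "Re ((map_mat complex_of_real M *\<^sub>v v) \<bullet>c v) = (M *\<^sub>v x) \<bullet>c x + (M *\<^sub>v y) \<bullet>c y"
    unfolding eq using v xy
    by (subst (1 2) cquadratic_form_conv_sum[of _ d])
      (simp_all add: psd_matD(1)[OF M] x_def y_def algebra_simps sum.distrib)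
  \<comment> \<open>The imaginary part collects the terms that mix \<open>x\<close> and
    \<open>y\<close>; they cancel because \<open>M\<close> is symmetric.\<close>
  moreover have "Im ((map_mat complex_of_real M *\<^sub>v v) \<bullet>c v) = 0"
  proof -
    have "Im ((map_mat complex_of_real M *\<^sub>v v) \<bullet>c v)
        = (\<Sum>i<d. \<Sum>j<d. M $$ (i, j) * y $ j * x $ i) - (\<Sum>i<d. \<Sum>j<d. M $$ (i, j) * x $ j * y $ i)"
      unfolding eq using v by (simp add: x_def y_def algebra_simps sum_subtractf)
    also have "(\<Sum>i<d. \<Sum>j<d. M $$ (i, j) * x $ j * y $ i) = (\<Sum>j<d. \<Sum>i<d. M $$ (j, i) * y $ i * x $ j)"
      by (subst sum.swap) (simp add: sym mult_ac)
    finally show ?thesis by simp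
  qed
  ultimately show "0 \<le> (map_mat complex_of_real M *\<^sub>v v) \<bullet>c v"
    using psd_matD(5)[OF M xy(1)] psd_matD(5)[OF M xy(2)] by (simp add: less_eq_complex_def)
qed

text \<open>The block matrix \<open>[Re H, - Im H; Im H, Re H] / sqrt 2\<close>; the scaling makes the map an
  isometry for the trace inner product.\<close>

definition realification :: "nat \<Rightarrow> complex mat \<Rightarrow> real mat" where
  "realification n H = mat (2 * n) (2 * n) (\<lambda>(i, j). let z = H $$ (i mod n, j mod n) in
     (if i div n = j div n then Re z else if i < n then - Im z else Im z) / sqrt 2)"

lemma sum_lessThan_double: "(\<Sum>i<2 * n. f i) = (\<Sum>i<n. f i) + (\<Sum>i<n. f (n + i))" for n :: nat
  using sum_lessThan_mult[of f 2 n] by (simp add: numeral_2_eq_2)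

lemma index_realification:
  assumes "i < n" "j < n"
  shows "realification n H $$ (i, j) = Re (H $$ (i, j)) / sqrt 2"
    "realification n H $$ (i, n + j) = - Im (H $$ (i, j)) / sqrt 2"
    "realification n H $$ (n + i, j) = Im (H $$ (i, j)) / sqrt 2"
    "realification n H $$ (n + i, n + j) = Re (H $$ (i, j)) / sqrt 2"
  using assms by (simp_all add: realification_def)

lemma realification_carrier [simp]: "realification n H \<in> carrier_mat (2 * n) (2 * n)"
  by (simp add: realification_def)

text \<open>At a vector with halves \<open>x\<close> and \<open>y\<close>, the quadratic form is
  that of \<open>H\<close> at \<open>x + i y\<close>, divided by \<open>sqrt 2\<close>.\<close>

lemma psd_mat_realification:
  assumes H: "psd_mat n H"
  shows "psd_mat (2 * n) (realification n H)"
  unfolding psd_mat_def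
proof (intro conjI ballI)
  have herm: "Re (H $$ (i, j)) = Re (H $$ (j, i))"
    "Im (H $$ (i, j)) / sqrt 2 = - (Im (H $$ (j, i)) / sqrt 2)"
    "- (Im (H $$ (i, j)) / sqrt 2) = Im (H $$ (j, i)) / sqrt 2" if "i < n" "j < n" for i j
    using psd_mat_entry_conjugate[OF H that] by (auto simp: complex_eq_iff field_simps)
  have cases: "(i < n \<Longrightarrow> P) \<Longrightarrow> (\<And>k. i = n + k \<Longrightarrow> k < n \<Longrightarrow> P) \<Longrightarrow> i < 2 * n \<Longrightarrow> P" for i P
    by (metis add_diff_inverse_nat mult_2 nat_add_left_cancel_less)
  show "mat_adjoint (realification n H) = realification n H"
  proof (rule eq_matI)
    fix i j assume "i < dim_row (realification n H)" "j < dim_col (realification n H)"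
    then have ij: "i < 2 * n" "j < 2 * n" by (auto simp: realification_def)
    have "mat_adjoint (realification n H) $$ (i, j) = realification n H $$ (j, i)"
      using ij carrier_matD[OF realification_carrier[of n H]] by simp
    also have "\<dots> = realification n H $$ (i, j)"
      by (rule cases[OF _ _ ij(1)]; rule cases[OF _ _ ij(2)])
        (auto simp: index_realification intro: herm)
    finally show "mat_adjoint (realification n H) $$ (i, j) = realification n H $$ (i, j)" .
  qed (simp_all add: realification_def)
  fix v :: "real vec" assume v: "v \<in> carrier_vec (2 * n)"
  define w where "w = vec n (\<lambda>i. Complex (v $ i) (v $ (n + i)))"
  have w: "w \<in> carrier_vec n" by (simp add: w_def)
  let ?R = "realification n H"
  have "(?R *\<^sub>v v) \<bullet>c v = (\<Sum>i<n. \<Sum>j<n. ?R $$ (i, j) * v $ j * v $ i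
      + ?R $$ (i, n + j) * v $ (n + j) * v $ i + ?R $$ (n + i, j) * v $ j * v $ (n + i)
      + ?R $$ (n + i, n + j) * v $ (n + j) * v $ (n + i))"
    unfolding cquadratic_form_conv_sum[OF realification_carrier v]
    by (simp add: sum_lessThan_double sum.distrib add_ac)
  also have "\<dots> = (\<Sum>i<n. \<Sum>j<n. Re (H $$ (i, j) * w $ j * cnj (w $ i)) / sqrt 2)"
  proof (rule sum.cong[OF refl], rule sum.cong[OF refl])
    fix i j assume "i \<in> {..<n}" "j \<in> {..<n}"
    then have ij: "i < n" "j < n" by auto
    show "?R $$ (i, j) * v $ j * v $ i
      + ?R $$ (i, n + j) * v $ (n + j) * v $ i + ?R $$ (n + i, j) * v $ j * v $ (n + i)
      + ?R $$ (n + i, n + j) * v $ (n + j) * v $ (n + i) = Re (H $$ (i, j) * w $ j * cnj (w $ i)) / sqrt 2"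
      unfolding index_realification[OF ij] using ij by (simp add: w_def field_simps)
  qed
  also have "\<dots> = Re ((H *\<^sub>v w) \<bullet>c w) / sqrt 2"
    unfolding cquadratic_form_conv_sum[OF psd_matD(1)[OF H] w]
    by (simp only: Re_sum sum_divide_distrib conjugate_complex_def)
  also have "0 \<le> \<dots>"
    using psd_matD(5)[OF H w] by (simp add: less_eq_complex_def)
  finally show "0 \<le> (realification n H *\<^sub>v v) \<bullet>c v" .
qed simp

text \<open>Products of real parts and products of imaginary parts each occur twice among the four
  blocks; the two factors \<open>1 / sqrt 2\<close> compensate for this.\<close>

lemma mat_trace_realification_mult:
  assumes "H \<in> carrier_mat n n" "H' \<in> carrier_mat n n"
  shows "mat_trace (realification n H * realification n H') = Re (mat_trace (H * H'))"
proof -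
  let ?R = "realification n H" and ?R' = "realification n H'"
  have "mat_trace (?R * ?R') = (\<Sum>i<n. \<Sum>j<n. ?R $$ (i, j) * ?R' $$ (j, i)
      + ?R $$ (i, n + j) * ?R' $$ (n + j, i) + ?R $$ (n + i, j) * ?R' $$ (j, n + i)
      + ?R $$ (n + i, n + j) * ?R' $$ (n + j, n + i))"
    unfolding mat_trace_mult[OF realification_carrier realification_carrier]
    by (simp add: sum_lessThan_double sum.distrib add_ac)
  also have "\<dots> = (\<Sum>i<n. \<Sum>j<n. Re (H $$ (i, j) * H' $$ (j, i)))"
  proof (rule sum.cong[OF refl], rule sum.cong[OF refl])
    fix i j assume "i \<in> {..<n}" "j \<in> {..<n}"
    then have ij: "i < n" "j < n" by auto
    show "?R $$ (i, j) * ?R' $$ (j, i)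
      + ?R $$ (i, n + j) * ?R' $$ (n + j, i) + ?R $$ (n + i, j) * ?R' $$ (j, n + i)
      + ?R $$ (n + i, n + j) * ?R' $$ (n + j, n + i) = Re (H $$ (i, j) * H' $$ (j, i))"
      unfolding index_realification[OF ij] index_realification[OF ij(2,1)] by simp
  qed
  also have "\<dots> = Re (mat_trace (H * H'))"
    unfolding mat_trace_mult[OF assms] by (simp only: Re_sum)
  finally show ?thesis .
qed

section \<open>Quantum correlations as trace inner products\<close>

lemma mat_sum_image:
  "inj_on f I \<Longrightarrow> mat_sum d (f ` I) P = mat_sum d I (\<lambda>i. P (f i))"
  by (simp add: mat_sum_def sum.reindex)

lemma psd_mat_add:
  fixes M N :: "'a :: conjugatable_ordered_field mat"
  assumes "psd_mat d M" "psd_mat d N"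
  shows "psd_mat d (M + N)"
proof -
  have "psd_mat d (mat_sum d UNIV (\<lambda>b. if b then M else N))"
    using assms by (intro psd_mat_sum) simp
  also have "mat_sum d UNIV (\<lambda>b. if b then M else N) = M + N"
    using psd_matD(3,4)[OF assms(1)] psd_matD(3,4)[OF assms(2)]
    by (intro eq_matI) (auto simp: UNIV_bool add.commute)
  finally show ?thesis .
qed

text \<open>The block of indices that belongs to one question. Questions of both parties live in one
  disjoint sum, so that conditions on all blocks, within a party or across, take the same
  form.\<close>

definition answers :: "'a set \<Rightarrow> 'b set \<Rightarrow> 's + 't \<Rightarrow> ('s \<times> 'a + 't \<times> 'b) set" where
  "answers A B q = (case q of Inl s \<Rightarrow> (\<lambda>a. Inl (s, a)) ` A | Inr t \<Rightarrow> (\<lambda>b. Inr (t, b)) ` B)"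

lemma mat_sum_answers:
  "mat_sum d (answers A B (Inl s)) F = mat_sum d A (\<lambda>a. F (Inl (s, a)))"
  "mat_sum d (answers A B (Inr t)) F = mat_sum d B (\<lambda>b. F (Inr (t, b)))"
  by (simp_all add: answers_def mat_sum_image inj_on_def)

lemma finite_answers: "finite A \<Longrightarrow> finite B \<Longrightarrow> finite (answers A B q)"
  by (auto simp: answers_def split: sum.splits)

lemma answers_subset: "q \<in> S <+> T \<Longrightarrow> answers A B q \<subseteq> (S \<times> A) <+> (T \<times> B)"
  by (auto simp: answers_def)

lemma answers_cover:
  assumes "x \<in> (S \<times> A) <+> (T \<times> B)"
  obtains q where "q \<in> S <+> T" "x \<in> answers A B q"
  using assms by (force simp: answers_def)

text \<open>The intermediate form between the tensor product model and real Gram matrices.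
  \<open>K\<close> stands for \<open>\<bar>\<Psi>\<bar>\<close>, up to a change of basis, and
  \<open>mat_trace (K * K) = 1\<close> expresses that the state is a unit vector.\<close>

definition psd_representation ::
    "'a set \<Rightarrow> 'b set \<Rightarrow> 's set \<Rightarrow> 't set \<Rightarrow> ('a \<times> 'b \<times> 's \<times> 't \<Rightarrow> real) \<Rightarrow>
      nat \<Rightarrow> complex mat \<Rightarrow> ('s \<times> 'a + 't \<times> 'b \<Rightarrow> complex mat) \<Rightarrow> bool" where
  "psd_representation A B S T p d K F \<longleftrightarrow>
     (\<forall>x\<in>(S \<times> A) <+> (T \<times> B). psd_mat d (F x)) \<and>
     (\<forall>q\<in>S <+> T. mat_sum d (answers A B q) F = K) \<and> mat_trace (K * K) = 1 \<and>
     (\<forall>a\<in>A. \<forall>b\<in>B. \<forall>s\<in>S. \<forall>t\<in>T.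
        complex_of_real (p (a, b, s, t)) = mat_trace (F (Inl (s, a)) * F (Inr (t, b))))"

text \<open>With \<open>\<Psi> = C D\<^sup>*\<close>, cyclicity splits the trace of
  \<open>\<Psi>\<^sup>* X \<Psi> Y\<^sup>T\<close> into the factors \<open>C\<^sup>* X C\<close> and
  \<open>D\<^sup>* Y\<^sup>T D\<close>. The balance \<open>C\<^sup>* C = D\<^sup>* D\<close> gives
  the operators of both parties the same sum \<open>K\<close>.\<close>

lemma quantum_correlation_imp_psd_representation:
  assumes "p \<in> quantum_correlations A B S T"
  shows "\<exists>d\<ge>1. \<exists>K F. psd_representation A B S T p d K F"
proof -
  obtain d e \<psi> X Y where \<psi>: "\<psi> \<in> carrier_vec (d * e)" "\<psi> \<bullet>c \<psi> = 1"
    and X: "\<And>s. s \<in> S \<Longrightarrow> povm d A (X s)" and Y: "\<And>t. t \<in> T \<Longrightarrow> povm e B (Y t)"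
    and p: "\<And>a b s t. a \<in> A \<Longrightarrow> b \<in> B \<Longrightarrow> s \<in> S \<Longrightarrow> t \<in> T \<Longrightarrow>
      complex_of_real (p (a, b, s, t)) = (kronecker (X s a) (Y t b) *\<^sub>v \<psi>) \<bullet>c \<psi>"
    using assms unfolding quantum_correlations_def by blast
  note X = X[unfolded povm_conv_mat_sum] and Y = Y[unfolded povm_conv_mat_sum]
  define \<Psi> where "\<Psi> = mat_of_tensor d e \<psi>"
  obtain C D where C: "C \<in> carrier_mat d e" and D: "D \<in> carrier_mat e e"
    and CD: "C * mat_adjoint D = \<Psi>" and CCDD: "mat_adjoint C * C = mat_adjoint D * D"
    using balanced_factorization[of \<Psi> d e] by (auto simp: \<Psi>_def)
  note [simp del] = assoc_mult_mat
  have [simp]: "dim_row C = d" "dim_col C = e" "dim_row D = e" "dim_col D = e"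
    using C D by auto
  have DC: "mat_adjoint \<Psi> = D * mat_adjoint C"
    by (simp add: CD[symmetric] mat_adjoint_mult)
  define K where "K = mat_adjoint C * C"
  define F where "F x = (case x of Inl (s, a) \<Rightarrow> mat_adjoint C * X s a * C
    | Inr (t, b) \<Rightarrow> mat_adjoint D * transpose_mat (Y t b) * D)" for x
  have psdF: "psd_mat e (F x)" if x: "x \<in> (S \<times> A) <+> (T \<times> B)" for x
  proof -
    consider (Inl) s a where "x = Inl (s, a)" "s \<in> S" "a \<in> A"
      | (Inr) t b where "x = Inr (t, b)" "t \<in> T" "b \<in> B"
      using x by auto
    then show ?thesis
    proof cases
      case Inl
      then show ?thesis using X[of s] psd_mat_congruence[OF _ C] by (simp add: F_def)
    next
      case Inr
      then show ?thesis using Y[of t] psd_mat_congruence[OF psd_mat_transpose D] by (simp add: F_def)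
    qed
  qed
  have sumF: "mat_sum e (answers A B q) F = K" if "q \<in> S <+> T" for q
  proof (cases q)
    case (Inl s)
    then have s: "s \<in> S" using that by auto
    have "mat_sum e (answers A B q) F = mat_adjoint C * mat_sum d A (X s) * C"
      unfolding Inl mat_sum_answers F_def using X[OF s]
      by (subst mat_sum_congruence[OF mat_adjoint_carrier[OF C] C]) (auto simp: psd_matD(1))
    then show ?thesis using X[OF s] by (simp add: K_def mult_mat_assoc_dim)
  next
    case (Inr t)
    then have t: "t \<in> T" using that by auto
    have "mat_sum e (answers A B q) F = mat_adjoint D * mat_sum e B (\<lambda>b. transpose_mat (Y t b)) * D"
      unfolding Inr mat_sum_answers F_def using Y[OF t]
      by (subst mat_sum_congruence[OF mat_adjoint_carrier[OF D] D]) (auto simp: psd_matD(1))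
    also have "mat_sum e B (\<lambda>b. transpose_mat (Y t b)) = 1\<^sub>m e"
      using Y[OF t] by (simp add: mat_sum_transpose psd_matD(1))
    finally show ?thesis by (simp add: K_def CCDD)
  qed
  \<comment> \<open>One factor \<open>K\<close> is read as \<open>C\<^sup>* C\<close>, the other as
    \<open>D\<^sup>* D\<close>; cyclicity then yields the trace of
    \<open>\<Psi>\<^sup>* \<Psi>\<close>, the squared norm of \<open>\<psi>\<close>.\<close>
  have trK: "mat_trace (K * K) = 1"
  proof -
    have "mat_trace (K * K) = mat_trace ((mat_adjoint C * (C * mat_adjoint D)) * D)"
      unfolding K_def by (subst (2) CCDD) (simp add: mult_mat_assoc_dim)
    also have "\<dots> = mat_trace (mat_adjoint \<Psi> * \<Psi>)"
      unfolding DC CD[symmetric] by (subst mat_trace_mult_comm) (simp_all add: mult_mat_assoc_dim mat_adjoint_mult)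
    finally show ?thesis using tensor_norm[OF \<psi>(1)] \<psi>(2) by (simp add: \<Psi>_def)
  qed
  have pF: "complex_of_real (p (a, b, s, t)) = mat_trace (F (Inl (s, a)) * F (Inr (t, b)))"
    if "a \<in> A" "b \<in> B" "s \<in> S" "t \<in> T" for a b s t
  proof -
    have Xsa: "X s a \<in> carrier_mat d d" and Ytb: "Y t b \<in> carrier_mat e e"
      using X[OF that(3)] Y[OF that(4)] that by (auto intro: psd_matD(1))
    then have [simp]: "dim_row (X s a) = d" "dim_col (X s a) = d" "dim_row (Y t b) = e" "dim_col (Y t b) = e"
      by auto
    have "complex_of_real (p (a, b, s, t))
        = mat_trace (mat_adjoint \<Psi> * (X s a * \<Psi> * transpose_mat (Y t b)))"
      unfolding p[OF that] \<Psi>_def by (rule kronecker_quadratic_form[OF Xsa Ytb \<psi>(1)])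
    also have "\<dots> = mat_trace (D * (mat_adjoint C * X s a * C * mat_adjoint D * transpose_mat (Y t b)))"
      unfolding DC CD[symmetric] by (simp add: mult_mat_assoc_dim mat_adjoint_mult)
    also have "\<dots> = mat_trace (F (Inl (s, a)) * F (Inr (t, b)))"
      by (subst mat_trace_mult_comm) (simp_all add: F_def mult_mat_assoc_dim)
    finally show ?thesis .
  qed
  \<comment> \<open>\<open>cpsd_cone\<close> asks for a positive dimension. In dimension 0 the trace
    of \<open>K * K\<close> would be an empty sum and not 1.\<close>
  have e1: "1 \<le> e"
  proof (rule ccontr)
    assume "\<not> 1 \<le> e"
    then have "e = 0" by simp
    then have "mat_trace (K * K) = 0"
      by (simp add: K_def mat_trace_def)
    with trK show False by simp
  qed
  show ?thesis
    unfolding psd_representation_def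
    by (intro exI[of _ e] conjI exI[of _ K] exI[of _ F] ballI psdF sumF trK pF e1)
qed

text \<open>Conjugation by \<open>W\<close> takes the sum \<open>K\<close> of each question to
  \<open>1 - Z\<close>. Adding \<open>Z\<close> to the operator of one fixed answer per question
  completes a measurement, and since \<open>\<Psi> Z = 0\<close> the state does not see this
  addition.\<close>

lemma psd_representation_imp_quantum_correlation:
  fixes A :: "'a set" and B :: "'b set" and S :: "'s set" and T :: "'t set"
  assumes rep: "psd_representation A B S T p d K F" and p: "p \<in> extensional (A \<times> B \<times> S \<times> T)"
    and A: "finite A" "A \<noteq> {}" and B: "finite B" "B \<noteq> {}" and S: "S \<noteq> {}"
  shows "p \<in> quantum_correlations A B S T"
proof -
  have F: "psd_mat d (F x)" if "x \<in> (S \<times> A) <+> (T \<times> B)" for x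
    using rep that by (auto simp: psd_representation_def)
  have FK: "mat_sum d (answers A B q) F = K" if "q \<in> S <+> T" for q
    using rep that by (auto simp: psd_representation_def)
  obtain s0 a0 b0 where s0: "s0 \<in> S" and a0: "a0 \<in> A" and b0: "b0 \<in> B" using A B S by blast
  have K: "psd_mat d K"
    unfolding FK[of "Inl s0", symmetric, OF InlI[OF s0]]
    by (intro psd_mat_sum F) (use answers_subset[of "Inl s0" S T A B] s0 in auto)
  obtain W \<Psi> Z where W: "W \<in> carrier_mat d d" and \<Psi>: "\<Psi> \<in> carrier_mat d d" "mat_adjoint \<Psi> = \<Psi>"
    and Z: "psd_mat d Z" and WKW: "mat_adjoint W * K * W + Z = 1\<^sub>m d" and \<Psi>Z: "\<Psi> * Z = 0\<^sub>m d d"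
    and KG: "K * (W * \<Psi> * mat_adjoint W) = K" and tr\<Psi>: "mat_trace (\<Psi> * \<Psi>) = mat_trace (K * K)"
    using psd_mat_normalization[OF K] by metis
  note [simp del] = assoc_mult_mat
  note Zc = psd_matD(1)[OF Z]
  have [simp]: "dim_row W = d" "dim_col W = d" "dim_row \<Psi> = d" "dim_col \<Psi> = d" "dim_row Z = d" "dim_col Z = d"
    "dim_row K = d" "dim_col K = d"
    using W \<Psi> psd_matD(3,4)[OF Z] psd_matD(3,4)[OF K] by auto
  have Z\<Psi>: "Z * \<Psi> = 0\<^sub>m d d"
    using arg_cong[OF \<Psi>Z, of mat_adjoint] psd_matD(2)[OF Z] \<Psi>(2)
    by (simp add: mat_adjoint_mult) (auto intro!: eq_matI)
  define G where "G = W * \<Psi> * mat_adjoint W"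
  have G: "G \<in> carrier_mat d d" unfolding G_def by (intro carrier_matI) simp_all
  \<comment> \<open>\<open>K G = K\<close> says that \<open>K\<close> annihilates the columns of
    \<open>1 - G\<close>; by positivity each summand \<open>F x\<close> of \<open>K\<close>
    annihilates them too.\<close>
  have FG: "F x * G = F x" if x: "x \<in> (S \<times> A) <+> (T \<times> B)" for x
  proof -
    obtain q where q: "q \<in> S <+> T" "x \<in> answers A B q" using answers_cover[OF x] .
    have "K * (1\<^sub>m d - G) = 0\<^sub>m d d"
      using psd_matD(1)[OF K] G
      by (subst mult_minus_distrib_mat[OF _ one_carrier_mat G]) (auto simp: KG[folded G_def])
    then have "F x * (1\<^sub>m d - G) = 0\<^sub>m d d"
      using answers_subset[OF q(1), of A B] FK[OF q(1)] G
      by (intro psd_mat_sum_kernel[OF F _ finite_answers[OF A(1) B(1)] q(2)]) auto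
    moreover have "F x * (1\<^sub>m d - G) = F x - F x * G"
      using mult_minus_distrib_mat[OF psd_matD(1)[OF F[OF x]] one_carrier_mat G]
        psd_matD(4)[OF F[OF x]] by simp
    ultimately have eq: "F x - F x * G = 0\<^sub>m d d" by simp
    show ?thesis
    proof (rule eq_matI)
      fix i j assume ij: "i < dim_row (F x)" "j < dim_col (F x)"
      then have "(F x - F x * G) $$ (i, j) = 0"
        unfolding eq using psd_matD(3,4)[OF F[OF x]] by simp
      then show "(F x * G) $$ (i, j) = F x $$ (i, j)"
        using ij psd_matD(3,4)[OF F[OF x]] G by (simp del: index_mult_mat(1))
    qed (use psd_matD(3,4)[OF F[OF x]] G in auto)
  qed
  \<comment> \<open>The flag \<open>\<delta>\<close> marks the one answer that receives the defect
    \<open>Z\<close>: \<open>a0\<close> for the first party, \<open>b0\<close> for the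
    second.\<close>
  define N where "N x \<delta> = mat_adjoint W * F x * W + (if \<delta> then Z else 0\<^sub>m d d)" for x \<delta>
  have psdN: "psd_mat d (N x \<delta>)" if "x \<in> (S \<times> A) <+> (T \<times> B)" for x \<delta>
  proof -
    have "psd_mat d (mat_sum d {} F)" by (intro psd_mat_sum) simp
    also have "mat_sum d {} F = 0\<^sub>m d d" by (intro eq_matI) simp_all
    finally show ?thesis
      unfolding N_def by (intro psd_mat_add psd_mat_congruence[OF F[OF that] W]) (simp add: Z)
  qed
  have sumN: "mat_sum d I (\<lambda>i. N (f i) (i = i0)) = 1\<^sub>m d"
    if "finite I" "i0 \<in> I" "mat_sum d I (\<lambda>i. F (f i)) = K" "f ` I \<subseteq> (S \<times> A) <+> (T \<times> B)"
    for I and i0 and f :: "'i \<Rightarrow> _"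
  proof -
    have fI: "f i \<in> (S \<times> A) <+> (T \<times> B)" if "i \<in> I" for i using \<open>f ` I \<subseteq> _\<close> that by auto
    have "mat_sum d I (\<lambda>i. N (f i) (i = i0)) = mat_sum d I (\<lambda>i. mat_adjoint W * F (f i) * W) + Z"
      using that(1,2)
      by (intro eq_matI)
        (auto simp: N_def sum.distrib if_distrib[of "\<lambda>M. M $$ _"] sum.delta
          simp del: index_mult_mat(1) cong: if_cong)
    also have "mat_sum d I (\<lambda>i. mat_adjoint W * F (f i) * W) = mat_adjoint W * K * W"
      unfolding that(3)[symmetric]
      using W psd_matD(1)[OF F[OF fI]] by (intro mat_sum_congruence[symmetric]) auto
    finally show ?thesis using WKW by simp
  qed
  define X where "X s a = N (Inl (s, a)) (a = a0)" for s a
  \<comment> \<open>This transpose cancels the one in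
    \<open>kronecker_quadratic_form\<close>.\<close>
  define Y where "Y t b = transpose_mat (N (Inr (t, b)) (b = b0))" for t b
  define \<psi> where "\<psi> = vec (d * d) (\<lambda>k. \<Psi> $$ (k div d, k mod d))"
  have \<psi>: "\<psi> \<in> carrier_vec (d * d)" by (simp add: \<psi>_def)
  have \<psi>\<Psi>: "mat_of_tensor d d \<psi> = \<Psi>"
    by (rule eq_matI) (simp_all add: mat_of_tensor_def \<psi>_def tensor_index_less)
  have norm: "\<psi> \<bullet>c \<psi> = 1"
    using rep unfolding tensor_norm[OF \<psi>] \<psi>\<Psi> \<Psi>(2) tr\<Psi> by (simp add: psd_representation_def)
  have povmX: "povm d A (X s)" if "s \<in> S" for s
    unfolding povm_conv_mat_sum X_def using that A a0 FK[of "Inl s"]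
    by (auto intro!: psdN sumN simp: mat_sum_answers)
  have povmY: "povm d B (Y t)" if "t \<in> T" for t
  proof -
    have "mat_sum d B (\<lambda>b. N (Inr (t, b)) (b = b0)) = 1\<^sub>m d"
      using that B b0 FK[of "Inr t"] by (intro sumN) (auto simp: mat_sum_answers)
    moreover have "psd_mat d (N (Inr (t, b)) (b = b0))" if "b \<in> B" for b
      using that \<open>t \<in> T\<close> by (intro psdN) auto
    ultimately show ?thesis
      unfolding povm_conv_mat_sum Y_def
      by (auto intro!: psd_mat_transpose simp: mat_sum_transpose psd_matD(1))
  qed
  have "complex_of_real (p (a, b, s, t)) = (kronecker (X s a) (Y t b) *\<^sub>v \<psi>) \<bullet>c \<psi>"
    if "a \<in> A" "b \<in> B" "s \<in> S" "t \<in> T" for a b s t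
  proof -
    let ?x = "Inl (s, a) :: 's \<times> 'a + 't \<times> 'b" and ?y = "Inr (t, b) :: 's \<times> 'a + 't \<times> 'b"
    have x: "?x \<in> (S \<times> A) <+> (T \<times> B)" and y: "?y \<in> (S \<times> A) <+> (T \<times> B)" using that by auto
    note [simp] = psd_matD(3,4)[OF F[OF x]] psd_matD(3,4)[OF F[OF y]]
    let ?P = "mat_adjoint W * F ?x * W" and ?Q = "mat_adjoint W * F ?y * W"
    have P: "?P \<in> carrier_mat d d" and Q: "?Q \<in> carrier_mat d d"
      by (intro carrier_matI; simp)+
    \<comment> \<open>Next to \<open>\<Psi>\<close> the defect \<open>Z\<close> disappears, on
      either side.\<close>
    have X\<Psi>: "X s a * \<Psi> = ?P * \<Psi>"
      unfolding X_def N_def using P Zc \<Psi>(1) Z\<Psi> by (subst add_mult_distrib_mat[of _ d d]) auto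
    have \<Psi>Y: "\<Psi> * transpose_mat (Y t b) = \<Psi> * ?Q"
      unfolding Y_def N_def transpose_transpose
      using Q Zc \<Psi>(1) \<Psi>Z by (subst mult_add_distrib_mat[of _ d d _ d]) auto
    have Xsa: "X s a \<in> carrier_mat d d" and Ytb: "Y t b \<in> carrier_mat d d"
      using povmX[OF that(3)] povmY[OF that(4)] that by (auto simp: povm_def intro: psd_matD(1))
    then have [simp]: "dim_row (X s a) = d" "dim_col (X s a) = d" "dim_row (Y t b) = d" "dim_col (Y t b) = d"
      by auto
    have "(kronecker (X s a) (Y t b) *\<^sub>v \<psi>) \<bullet>c \<psi> = mat_trace (\<Psi> * (X s a * \<Psi> * transpose_mat (Y t b)))"
      unfolding kronecker_quadratic_form[OF Xsa Ytb \<psi>] \<psi>\<Psi> \<Psi>(2) ..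
    also have "X s a * \<Psi> * transpose_mat (Y t b) = ?P * (\<Psi> * ?Q)"
      unfolding \<Psi>Y[symmetric] X\<Psi> using P Ytb by (subst mult_mat_assoc_dim) (auto simp: X\<Psi> mult_mat_assoc_dim)
    \<comment> \<open>Regrouping and cyclicity produce \<open>W \<Psi> W\<^sup>* = G\<close> once
      after \<open>F ?x\<close> and once after \<open>F ?y\<close>; \<open>FG\<close> absorbs it
      both times.\<close>
    also have "mat_trace (\<Psi> * (?P * (\<Psi> * ?Q))) = mat_trace (\<Psi> * mat_adjoint W * (F ?x * G) * F ?y * W)"
      by (simp add: G_def mult_mat_assoc_dim)
    also have "\<dots> = mat_trace (W * (\<Psi> * mat_adjoint W * F ?x * F ?y))"
      unfolding FG[OF x] by (subst mat_trace_mult_comm) simp_all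
    also have "\<dots> = mat_trace (G * (F ?x * F ?y))"
      by (simp add: G_def mult_mat_assoc_dim)
    also have "\<dots> = mat_trace (F ?x * (F ?y * G))"
      using G by (subst mat_trace_mult_comm) (auto simp: mult_mat_assoc_dim)
    also have "\<dots> = complex_of_real (p (a, b, s, t))"
      unfolding FG[OF y] using rep that by (simp add: psd_representation_def)
    finally show ?thesis ..
  qed
  then show ?thesis
    unfolding quantum_correlations_def using p \<psi> norm povmX povmY by blast
qed

section \<open>Compactness of the set of correlation matrices\<close>

text \<open>For symmetric matrices the squared Frobenius distance of \<open>Y\<close> and
  \<open>Z\<close> is \<open>1 - 2 + 1 = 0\<close>. This is how block sums equal to 1 force the
  operators of all questions to have the same sum.\<close>

lemma real_psd_eqI:
  fixes Y Z :: "real mat"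
  assumes Y: "psd_mat d Y" and Z: "psd_mat d Z"
    and tr: "mat_trace (Y * Y) = 1" "mat_trace (Y * Z) = 1" "mat_trace (Z * Z) = 1"
  shows "Y = Z"
proof -
  note c = psd_matD(1)[OF Y] psd_matD(1)[OF Z]
  have sym: "Y $$ (j, i) = Y $$ (i, j)" "Z $$ (j, i) = Z $$ (i, j)" if "i < d" "j < d" for i j
    using psd_mat_entry_conjugate[OF Y that] psd_mat_entry_conjugate[OF Z that] by simp_all
  have tr_sum: "mat_trace (M * N) = (\<Sum>i<d. \<Sum>j<d. M $$ (i, j) * N $$ (i, j))"
    if "M \<in> {Y, Z}" "N \<in> {Y, Z}" for M N
  proof -
    have "M \<in> carrier_mat d d" "N \<in> carrier_mat d d" using that c by auto
    then have "mat_trace (M * N) = (\<Sum>i<d. \<Sum>j<d. M $$ (i, j) * N $$ (j, i))"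
      by (rule mat_trace_mult)
    also have "\<dots> = (\<Sum>i<d. \<Sum>j<d. M $$ (i, j) * N $$ (i, j))"
      by (intro sum.cong refl) (use that sym in auto)
    finally show ?thesis .
  qed
  have "(\<Sum>i<d. \<Sum>j<d. (Y $$ (i, j) - Z $$ (i, j))\<^sup>2) = (\<Sum>i<d. \<Sum>j<d.
      Y $$ (i, j) * Y $$ (i, j) - 2 * (Y $$ (i, j) * Z $$ (i, j)) + Z $$ (i, j) * Z $$ (i, j))"
    by (simp add: power2_eq_square algebra_simps)
  also have "\<dots> = mat_trace (Y * Y) - 2 * mat_trace (Y * Z) + mat_trace (Z * Z)"
    by (simp only: tr_sum insertI1 insertI2 sum.distrib sum_subtractf sum_distrib_left)
  also have "\<dots> = 0" by (simp add: tr)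
  finally have "(\<Sum>i<d. \<Sum>j<d. (Y $$ (i, j) - Z $$ (i, j))\<^sup>2) = 0" .
  then have "Y $$ (i, j) = Z $$ (i, j)" if "i < d" "j < d" for i j
    using that by (simp add: sum_nonneg_eq_0_iff sum_nonneg)
  then show ?thesis using c by (intro eq_matI) auto
qed

text \<open>\<open>h\<close> enumerates the question-answer pairs, because \<open>cpsd_cone\<close>
  indexes its matrices by numbers. The box supplies boundedness for the compactness
  argument.\<close>

definition correlation_gram_matrices ::
    "'a set \<Rightarrow> 'b set \<Rightarrow> 's set \<Rightarrow> 't set \<Rightarrow> nat \<Rightarrow> ('s \<times> 'a + 't \<times> 'b \<Rightarrow> nat) \<Rightarrow>
      (nat \<times> nat \<Rightarrow> real) set" where
  "correlation_gram_matrices A B S T n h =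
     {M \<in> cpsd_cone n \<inter> ({..<n} \<times> {..<n} \<rightarrow>\<^sub>E {0..1}).
       \<forall>q\<in>S <+> T. \<forall>r\<in>S <+> T. (\<Sum>x\<in>answers A B q. \<Sum>y\<in>answers A B r. M (h x, h y)) = 1}"

definition gram_correlation ::
    "'a set \<Rightarrow> 'b set \<Rightarrow> 's set \<Rightarrow> 't set \<Rightarrow> ('s \<times> 'a + 't \<times> 'b \<Rightarrow> nat) \<Rightarrow>
      (nat \<times> nat \<Rightarrow> real) \<Rightarrow> 'a \<times> 'b \<times> 's \<times> 't \<Rightarrow> real" where
  "gram_correlation A B S T h M =
     (\<lambda>(a, b, s, t)\<in>A \<times> B \<times> S \<times> T. M (h (Inl (s, a)), h (Inr (t, b))))"

text \<open>By bilinearity the block sums are the trace inner products of the question sums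
  \<open>Z q\<close>. All of them equal 1, so \<open>real_psd_eqI\<close> identifies the
  \<open>Z q\<close>, and the matrices, read as complex ones, form a
  \<open>psd_representation\<close>.\<close>

lemma gram_correlation_quantum:
  fixes A :: "'a set" and B :: "'b set" and S :: "'s set" and T :: "'t set"
  assumes M: "M \<in> correlation_gram_matrices A B S T n h"
    and h: "bij_betw h ((S \<times> A) <+> (T \<times> B)) {..<n}"
    and A: "finite A" "A \<noteq> {}" and B: "finite B" "B \<noteq> {}" and S: "S \<noteq> {}"
  shows "gram_correlation A B S T h M \<in> quantum_correlations A B S T"
proof -
  let ?I = "(S \<times> A) <+> (T \<times> B)"
  obtain d X where X: "\<And>i. i < n \<Longrightarrow> psd_mat d (X i)"
    and MX: "M = (\<lambda>(i, j) \<in> {..<n} \<times> {..<n}. mat_trace (X i * X j))"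
    using M unfolding correlation_gram_matrices_def cpsd_cone_def by blast
  have hn: "h x < n" if "x \<in> ?I" for x using h that by (auto dest: bij_betwE)
  define G where "G x = X (h x)" for x
  have G: "psd_mat d (G x)" if "x \<in> ?I" for x
    unfolding G_def using hn[OF that] by (rule X)
  have MG: "M (h x, h y) = mat_trace (G x * G y)" if "x \<in> ?I" "y \<in> ?I" for x y
    using hn[OF that(1)] hn[OF that(2)] by (simp add: MX G_def)
  have ans: "x \<in> ?I" if "x \<in> answers A B q" "q \<in> S <+> T" for x q
    using that answers_subset by blast
  define Z where "Z q = mat_sum d (answers A B q) G" for q
  have psdZ: "psd_mat d (Z q)" if "q \<in> S <+> T" for q
    unfolding Z_def using ans that by (intro psd_mat_sum G)
  have trZ: "mat_trace (Z q * Z r) = 1" if "q \<in> S <+> T" "r \<in> S <+> T" for q r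
  proof -
    have "mat_trace (Z q * Z r) = (\<Sum>x\<in>answers A B q. \<Sum>y\<in>answers A B r. mat_trace (G x * G y))"
      unfolding Z_def by (intro mat_trace_mat_sum_mult psd_matD(1)[OF G] ans[OF _ that(1)] ans[OF _ that(2)])
    also have "\<dots> = (\<Sum>x\<in>answers A B q. \<Sum>y\<in>answers A B r. M (h x, h y))"
      by (intro sum.cong refl MG[symmetric] ans[OF _ that(1)] ans[OF _ that(2)])
    also have "\<dots> = 1"
      using M that by (simp add: correlation_gram_matrices_def)
    finally show ?thesis .
  qed
  obtain q0 where q0: "q0 \<in> S <+> T" using S by blast
  have ZK: "Z q = Z q0" if "q \<in> S <+> T" for q
    using that q0 by (intro real_psd_eqI[of d] psdZ trZ)
  define F where "F x = map_mat complex_of_real (G x)" for x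
  define K where "K = map_mat complex_of_real (Z q0)"
  have trace_of_real: "mat_trace (map_mat complex_of_real P * map_mat complex_of_real Q) =
      complex_of_real (mat_trace (P * Q))" if "psd_mat d P" "psd_mat d Q" for P Q
    using psd_matD(1,3,4)[OF that(1)] psd_matD(1,3,4)[OF that(2)]
    by (subst (1 2) mat_trace_mult[of _ d d]) simp_all
  have "psd_representation A B S T (gram_correlation A B S T h M) d K F"
    unfolding psd_representation_def
  proof (intro conjI ballI)
    fix x assume "x \<in> ?I"
    then show "psd_mat d (F x)" unfolding F_def by (intro psd_mat_of_real G)
  next
    fix q assume q: "q \<in> S <+> T"
    have "mat_sum d (answers A B q) F = map_mat complex_of_real (Z q)"
      using psd_matD(3,4)[OF G[OF ans[OF _ q]]]
      by (intro eq_matI) (auto simp: Z_def F_def)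
    then show "mat_sum d (answers A B q) F = K" by (simp add: ZK[OF q] K_def)
  next
    show "mat_trace (K * K) = 1"
      unfolding K_def using trace_of_real[OF psdZ psdZ] q0 trZ[OF q0 q0] by simp
  next
    fix a b s t assume "a \<in> A" "b \<in> B" "s \<in> S" "t \<in> T"
    then show "complex_of_real (gram_correlation A B S T h M (a, b, s, t)) =
        mat_trace (F (Inl (s, a)) * F (Inr (t, b)))"
      unfolding F_def by (subst trace_of_real) (auto simp: gram_correlation_def MG[OF InlI InrI] intro!: G)
  qed
  then show ?thesis
    by (rule psd_representation_imp_quantum_correlation[OF _ _ A B S]) (simp add: gram_correlation_def)
qed

text \<open>The Gram matrix of a \<open>psd_representation\<close> has all block sums equal to the
  trace of \<open>K * K\<close>, which is 1. Its entries are nonnegative, so these sums also bound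
  them by 1.\<close>

lemma quantum_correlation_gram:
  fixes A :: "'a set" and B :: "'b set" and S :: "'s set" and T :: "'t set"
  assumes p: "p \<in> quantum_correlations A B S T"
    and h: "bij_betw h ((S \<times> A) <+> (T \<times> B)) {..<n}" and A: "finite A" and B: "finite B"
  shows "p \<in> gram_correlation A B S T h ` correlation_gram_matrices A B S T n h"
proof -
  let ?I = "(S \<times> A) <+> (T \<times> B)"
  obtain d K F where d: "1 \<le> d" and rep: "psd_representation A B S T p d K F"
    using quantum_correlation_imp_psd_representation[OF p] by blast
  have F: "psd_mat d (F x)" if "x \<in> ?I" for x
    using rep that by (auto simp: psd_representation_def)
  have FK: "mat_sum d (answers A B q) F = K" if "q \<in> S <+> T" for q
    using rep that by (auto simp: psd_representation_def)
  have trK: "mat_trace (K * K) = 1"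
    and pF: "\<And>a b s t. a \<in> A \<Longrightarrow> b \<in> B \<Longrightarrow> s \<in> S \<Longrightarrow> t \<in> T \<Longrightarrow>
      complex_of_real (p (a, b, s, t)) = mat_trace (F (Inl (s, a)) * F (Inr (t, b)))"
    using rep by (auto simp: psd_representation_def)
  define g where "g = inv_into ?I h"
  have gh: "g (h x) = x" if "x \<in> ?I" for x
    using h that by (simp add: g_def bij_betw_inv_into_left)
  have g: "g i \<in> ?I" if "i < n" for i
    using bij_betwE[OF bij_betw_inv_into[OF h]] that by (simp add: g_def)
  have hn: "h x < n" if "x \<in> ?I" for x using h that by (auto dest: bij_betwE)
  \<comment> \<open>Traces of products of psd matrices are real, so the real part loses
    nothing.\<close>
  define m where "m x y = Re (mat_trace (F x * F y))" for x y
  have ans: "x \<in> ?I" if "x \<in> answers A B q" "q \<in> S <+> T" for x q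
    using that answers_subset by blast
  have sum1: "(\<Sum>x\<in>answers A B q. \<Sum>y\<in>answers A B r. m x y) = 1"
    if "q \<in> S <+> T" "r \<in> S <+> T" for q r
  proof -
    have "mat_trace (K * K) = (\<Sum>x\<in>answers A B q. \<Sum>y\<in>answers A B r. mat_trace (F x * F y))"
      by (subst FK[OF that(1), symmetric], subst FK[OF that(2), symmetric])
        (intro mat_trace_mat_sum_mult psd_matD(1)[OF F] ans[OF _ that(1)] ans[OF _ that(2)])
    then have "Re (\<Sum>x\<in>answers A B q. \<Sum>y\<in>answers A B r. mat_trace (F x * F y)) = 1"
      using trK by simp
    then show ?thesis by (simp only: m_def Re_sum)
  qed
  have m0: "0 \<le> m x y" if "x \<in> ?I" "y \<in> ?I" for x y
    using mat_trace_psd_mult_nonneg[OF F F] that by (simp add: m_def less_eq_complex_def)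
  \<comment> \<open>Each entry is one of the nonnegative summands of a block whose sum is 1.\<close>
  have m1: "m x y \<le> 1" if xy: "x \<in> ?I" "y \<in> ?I" for x y
  proof -
    obtain q where q: "q \<in> S <+> T" "x \<in> answers A B q" using answers_cover[OF xy(1)] .
    obtain r where r: "r \<in> S <+> T" "y \<in> answers A B r" using answers_cover[OF xy(2)] .
    have "m x y \<le> (\<Sum>y\<in>answers A B r. m x y)"
      using r q by (intro member_le_sum m0 finite_answers A B) (auto intro: ans)
    also have "\<dots> \<le> (\<Sum>x\<in>answers A B q. \<Sum>y\<in>answers A B r. m x y)"
      using r q
      by (intro member_le_sum[of x _ "\<lambda>x. \<Sum>y\<in>answers A B r. m x y"] sum_nonneg m0 finite_answers A B)
        (auto intro: ans)
    finally show ?thesis using sum1[OF q(1) r(1)] by simp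
  qed
  \<comment> \<open>\<open>cpsd_cone\<close> asks for real matrices; realification doubles the
    dimension and keeps the entries \<open>m\<close>.\<close>
  define X where "X i = realification d (F (g i))" for i
  define M where "M = (\<lambda>(i, j) \<in> {..<n} \<times> {..<n}. mat_trace (X i * X j))"
  have Mm: "M (i, j) = m (g i) (g j)" if "i < n" "j < n" for i j
    using that psd_matD(1)[OF F[OF g[OF that(1)]]] psd_matD(1)[OF F[OF g[OF that(2)]]]
    by (simp add: M_def X_def m_def mat_trace_realification_mult)
  have Mh: "M (h x, h y) = m x y" if "x \<in> ?I" "y \<in> ?I" for x y
    using Mm[OF hn[OF that(1)] hn[OF that(2)]] gh[OF that(1)] gh[OF that(2)] by simp
  have "M \<in> cpsd_cone n"
  proof -
    have "\<forall>i<n. psd_mat (2 * d) (X i)"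
      using F g by (auto simp: X_def intro!: psd_mat_realification)
    moreover have "1 \<le> 2 * d" using d by simp
    ultimately show ?thesis unfolding cpsd_cone_def M_def by blast
  qed
  moreover have "M \<in> {..<n} \<times> {..<n} \<rightarrow>\<^sub>E {0..1}"
  proof (rule PiE_I)
    fix z assume "z \<in> {..<n} \<times> {..<n}"
    then obtain i j where z: "z = (i, j)" "i < n" "j < n" by auto
    then show "M z \<in> {0..1}"
      using Mm[OF z(2,3)] m0[OF g g, OF z(2,3)] m1[OF g g, OF z(2,3)] by simp
  qed (simp add: M_def)
  moreover have "(\<Sum>x\<in>answers A B q. \<Sum>y\<in>answers A B r. M (h x, h y)) = 1"
    if "q \<in> S <+> T" "r \<in> S <+> T" for q r
    unfolding sum1[OF that, symmetric] by (intro sum.cong refl Mh ans[OF _ that(1)] ans[OF _ that(2)])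
  ultimately have "M \<in> correlation_gram_matrices A B S T n h"
    unfolding correlation_gram_matrices_def by blast
  moreover have "p = gram_correlation A B S T h M"
  proof (rule extensionalityI[of _ "A \<times> B \<times> S \<times> T"])
    show "p \<in> extensional (A \<times> B \<times> S \<times> T)" using p by (simp add: quantum_correlations_def)
    show "gram_correlation A B S T h M \<in> extensional (A \<times> B \<times> S \<times> T)"
      by (simp add: gram_correlation_def)
    fix z assume "z \<in> A \<times> B \<times> S \<times> T"
    then obtain a b s t where z: "z = (a, b, s, t)" "a \<in> A" "b \<in> B" "s \<in> S" "t \<in> T" by auto
    have "p z = m (Inl (s, a)) (Inr (t, b))"
      using arg_cong[OF pF[OF z(2-5)], of Re] by (simp add: z(1) m_def)
    then show "p z = gram_correlation A B S T h M z"
      using z by (simp add: gram_correlation_def Mh[OF InlI InrI])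
  qed
  ultimately show ?thesis by blast
qed

theorem proposition3p9:
  fixes A :: "'a set" and B :: "'b set" and S :: "'s set" and T :: "'t set"
  assumes "\<forall>n\<ge>1. closedin (powertop_real ({..<n} \<times> {..<n})) (cpsd_cone n)"
    and "finite A" "A \<noteq> {}" and "finite B" "B \<noteq> {}"
    and "finite S" "S \<noteq> {}" and "finite T" "T \<noteq> {}"
  shows "closedin (powertop_real (A \<times> B \<times> S \<times> T)) (quantum_correlations A B S T)"
proof -
  let ?I = "(S \<times> A) <+> (T \<times> B)"
  define n where "n = card ?I"
  have I: "finite ?I" "?I \<noteq> {}" using assms by auto
  \<comment> \<open>The closedness hypothesis speaks of \<open>n \<ge> 1\<close> only.\<close>
  then have n: "1 \<le> n" by (simp add: n_def Suc_le_eq card_gt_0_iff)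
  obtain h where h: "bij_betw h ?I {..<n}"
    using ex_bij_betw_finite_nat[OF I(1)] by (auto simp: n_def lessThan_atLeast0)
  have hn: "h x < n" if "x \<in> ?I" for x using h that by (auto dest: bij_betwE)
  define Q where "Q = S <+> T"
  have Q: "Q \<noteq> {}" using assms(7) by (auto simp: Q_def)
  let ?X = "powertop_real ({..<n} \<times> {..<n})" and ?box = "{..<n} \<times> {..<n} \<rightarrow>\<^sub>E {0..1 :: real}"
  let ?f = "\<lambda>q r M. \<Sum>x\<in>answers A B q. \<Sum>y\<in>answers A B r. M (h x, h y)"
  \<comment> \<open>The block sum conditions as preimages of the closed set \<open>{1}\<close> under
    continuous maps.\<close>
  let ?C = "cpsd_cone n \<inter> (\<Inter>q\<in>Q. \<Inter>r\<in>Q. {M \<in> topspace ?X. ?f q r M \<in> {1}})"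
  have cont: "continuous_map ?X euclideanreal (?f q r)" if qr: "q \<in> Q" "r \<in> Q" for q r
  proof -
    have "continuous_map ?X euclideanreal (\<lambda>M. M (h x, h y))"
      if "x \<in> answers A B q" "y \<in> answers A B r" for x y
    proof -
      have "x \<in> ?I" "y \<in> ?I"
        using that qr answers_subset[of q S T A B] answers_subset[of r S T A B] by (auto simp only: Q_def)
      then show ?thesis
        by (intro continuous_map_product_projection[of "(h x, h y)" _ "\<lambda>_. euclideanreal"])
          (simp add: hn)
    qed
    then show ?thesis
      by (intro continuous_map_sum finite_answers assms(2,4))
  qed
  have "closedin ?X (\<Inter>q\<in>Q. \<Inter>r\<in>Q. {M \<in> topspace ?X. ?f q r M \<in> {1}})"
    by (intro closedin_INT Q closedin_continuous_map_preimage[OF cont]) simp_all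
  then have "closedin ?X ?C"
    using assms(1) n by blast
  moreover have "compactin ?X ?box"
    by (simp add: compactin_PiE)
  ultimately have "compactin ?X (?C \<inter> ?box)"
    by (rule closed_Int_compactin)
  also have "?C \<inter> ?box = correlation_gram_matrices A B S T n h"
  proof -
    have "?box \<subseteq> topspace ?X" by (auto simp: PiE_iff)
    then show ?thesis
      using Q unfolding correlation_gram_matrices_def Q_def[symmetric] by blast
  qed
  finally have compact: "compactin ?X (correlation_gram_matrices A B S T n h)" .
  \<comment> \<open>Each coordinate of the image is a coordinate of \<open>M\<close>.\<close>
  have "continuous_map ?X (powertop_real (A \<times> B \<times> S \<times> T)) (gram_correlation A B S T h)"
    unfolding continuous_map_componentwise
  proof (intro conjI ballI)
    fix z assume "z \<in> A \<times> B \<times> S \<times> T"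
    then obtain a b s t where z: "z = (a, b, s, t)" "a \<in> A" "b \<in> B" "s \<in> S" "t \<in> T" by auto
    then have "h (Inl (s, a)) < n" "h (Inr (t, b)) < n" by (auto intro!: hn)
    then show "continuous_map ?X euclideanreal (\<lambda>M. gram_correlation A B S T h M z)"
      using z continuous_map_product_projection[of
           "(h (Inl (s, a)), h (Inr (t, b)))" "{..<n} \<times> {..<n}" "\<lambda>_. euclideanreal"]
      by (simp add: gram_correlation_def)
  qed (auto simp: gram_correlation_def)
  then have "compactin (powertop_real (A \<times> B \<times> S \<times> T))
      (gram_correlation A B S T h ` correlation_gram_matrices A B S T n h)"
    by (rule image_compactin[OF compact])
  also have "gram_correlation A B S T h ` correlation_gram_matrices A B S T n h
      = quantum_correlations A B S T"
    using gram_correlation_quantum[OF _ h assms(2-5) assms(7)] quantum_correlation_gram[OF _ h assms(2,4)]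
    by blast
  finally have "compactin (powertop_real (A \<times> B \<times> S \<times> T)) (quantum_correlations A B S T)" .
  \<comment> \<open>The set of correlations is a continuous image of a compact set, hence compact,
    and compact sets in a Hausdorff space are closed.\<close>
  moreover have "Hausdorff_space euclideanreal"
    unfolding Hausdorff_space_def disjnt_def using hausdorff by auto
  ultimately show ?thesis
    by (intro compactin_imp_closedin) (simp_all add: Hausdorff_space_product_topology)
qed

end
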